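(* Let $G$ be a finite simple graph with more than three vertices and adjacency matrix $A$. Let $i$ and $j$ be distinct vertices of $G$ with neighbors $i'$ and $j'$, respectively, such that $ii'$ and $jj'$ are cut-edges (here $i'$ and $j'$ may be equal to each other, and $i'$ may equal $j$ and $j'$ may equal $i$). Assume that the removal of $ii'$ and the removal of $jj'$ each separate $i$ and $j$ into two different connected components. Then there is no perfect state transfer between $i$ and $j$.
   Context: Perfect state transfer from vertex $i$ to vertex $j$ means that there exist a real $t>0$ and $\lambda\in\mathbb{C}$ such that $\exp(\mathrm{i} t A)e_i=\lambda e_j$, where $e_v$ denotes the characteristic vector of vertex $v$ and $\mathrm{i}=\sqrt{-1}$.
   Formalization: The connected component containing i and j is also assumed to have more than three vertices (automatic if G is connected); otherwise the claim fails, e.g. for K2 plus two isolated vertices with i, j the ends of K2. *)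

theory Defs
  imports "HOL-Analysis.Analysis" "Graph_Theory.Graph_Theory"
begin

text \<open>
  A finite simple graph is a \<^locale>\<open>pair_graph\<close>: a finite, loopless, symmetric digraph in which an
  undirected edge \<open>uv\<close> is the pair of arcs \<open>(u,v)\<close>, \<open>(v,u)\<close>. Because the arc relation is symmetric,
  strongly connected components (\<open>sccs_verts\<close>, \<open>scc_of\<close>) are the connected components.
\<close>

definition adjacency_matrix :: "'v pair_pre_digraph \<Rightarrow> complex ^ 'v ^ 'v" where
  "adjacency_matrix G = (\<chi> u v. if (u, v) \<in> parcs G then 1 else 0)"

definition delete_edge :: "'v pair_pre_digraph \<Rightarrow> 'v \<Rightarrow> 'v \<Rightarrow> 'v pair_pre_digraph" where
  "delete_edge G u v = G\<lparr>parcs := parcs G - {(u, v), (v, u)}\<rparr>"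

definition cut_edge :: "'v pair_pre_digraph \<Rightarrow> 'v \<Rightarrow> 'v \<Rightarrow> bool" where
  "cut_edge G u v \<longleftrightarrow> (u, v) \<in> parcs G \<and>
     card (pre_digraph.sccs_verts (with_proj (delete_edge G u v)))
       > card (pre_digraph.sccs_verts (with_proj G))"

text \<open>Deleting the edge \<open>uv\<close> puts \<open>x\<close> and \<open>y\<close>, previously in one component, into two.\<close>

definition separates :: "'v pair_pre_digraph \<Rightarrow> 'v \<Rightarrow> 'v \<Rightarrow> 'v \<Rightarrow> 'v \<Rightarrow> bool" where
  "separates G u v x y \<longleftrightarrow>
     pre_digraph.scc_of (with_proj G) x = pre_digraph.scc_of (with_proj G) y \<and>
     pre_digraph.scc_of (with_proj (delete_edge G u v)) x
       \<noteq> pre_digraph.scc_of (with_proj (delete_edge G u v)) y"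

text \<open>
  The library's \<^const>\<open>exp\<close> does not apply to \<open>complex ^ 'n ^ 'n\<close>, whose multiplication \<open>**\<close> is not the
  type-class \<open>*\<close>; the series below is taken in the (entrywise) topology of that type,
  where it converges for every matrix.
\<close>

definition matrix_power :: "'a::semiring_1 ^ 'n ^ 'n \<Rightarrow> nat \<Rightarrow> 'a ^ 'n ^ 'n" where
  "matrix_power M k = ((**) M ^^ k) (mat 1)"

definition matrix_exp :: "complex ^ 'n ^ 'n \<Rightarrow> complex ^ 'n ^ 'n" where
  "matrix_exp M = (\<Sum>k. matrix_power M k /\<^sub>R fact k)"

definition perfect_state_transfer :: "'v::finite pair_pre_digraph \<Rightarrow> 'v \<Rightarrow> 'v \<Rightarrow> bool" where
  "perfect_state_transfer G i j \<longleftrightarrow>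
     (\<exists>t::real. \<exists>\<gamma>::complex. t > 0 \<and>
        matrix_exp (\<chi> u v. \<i> * of_real t * adjacency_matrix G $ u $ v) *v axis i 1
          = \<gamma> *s axis j 1)"

end

theory Submission
  imports Defs "HOL-Computational_Algebra.Polynomial"
begin

text \<open>
  Write \<open>e\<^sub>i = \<Sum>\<^sub>l w\<^sub>l\<close> with eigenvectors of the adjacency matrix. Perfect state transfer from \<open>i\<close> to \<open>j\<close>
  gives \<open>e\<^sub>j = \<Sum>\<^sub>l \<sigma>\<^sub>l w\<^sub>l\<close> with signs \<open>\<sigma>\<^sub>l\<close>; let \<open>P\<close> and \<open>M\<close> be the sets of eigenvalues with sign \<open>1\<close>
  and \<open>-1\<close>. Phases force the gaps \<open>l - m\<close> between \<open>P\<close> and \<open>M\<close> to be odd multiples of \<open>\<pi>/t\<close> and the gaps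
  inside \<open>P\<close> to be even multiples. The moments of the squared gaps are integers, which makes the squared gaps
  integers, and comparing moments modulo 2 makes them even; so \<open>(l - m)\<^sup>2 \<ge> 2\<close> for \<open>l \<in> P\<close>, \<open>m \<in> M\<close>.

  Conversely a bridge at \<open>i\<close> limits the gaps: projecting onto the side of the bridge containing \<open>i\<close> and taking
  the commutator with the adjacency matrix expresses \<open>(l - m) \<langle>w\<^sub>l, w\<^sub>m\<rangle>\<close>, restricted to that side, by the
  entries at the ends of the bridge. Summation then leaves only the cases that \<open>P\<close> or \<open>M\<close> is a singleton,
  with all squared gaps equal to 2 if \<open>i' \<noteq> j\<close>. So \<open>e\<^sub>i + e\<^sub>j\<close> or \<open>e\<^sub>i - e\<^sub>j\<close> is an eigenvector, and the
  component of \<open>i\<close> is \<open>{i, j}\<close> or \<open>{i, i', j}\<close>.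
\<close>

section \<open>Nodes with integer moments\<close>

text \<open>Over the rationals \<open>x\<close> and 1 are linearly independent, so their images
  under a rational-linear map can be prescribed. Homogeneity is recorded for integers, since it will
  be applied to integer moments.\<close>

lemma irrational_separating_functional:
  fixes x :: real
  assumes "x \<notin> \<rat>"
  obtains \<phi> :: "real \<Rightarrow> real"
  where "\<And>a b. \<phi> (a + b) = \<phi> a + \<phi> b" "\<And>z a. \<phi> (a * of_int z) = \<phi> a * of_int z"
    "\<phi> 1 = 0" "\<phi> x = 1"
proof -
  interpret V: vector_space "\<lambda>(q::rat) (y::real). of_rat q * y"
    by unfold_locales (auto simp: algebra_simps of_rat_add of_rat_mult)
  interpret VP: vector_space_pair "\<lambda>(q::rat) (y::real). of_rat q * y" "\<lambda>(q::rat) (y::real). of_rat q * y"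
    by unfold_locales
  have "x \<noteq> 1" using assms by auto
  have "V.independent {1::real}" by (simp add: V.dependent_single)
  moreover have "x \<notin> V.span {1}"
    using assms by (auto simp: V.span_singleton)
  ultimately have ind: "V.independent {x, 1}"
    by (rule V.independent_insertI[rotated])
  define \<phi> where "\<phi> = VP.construct {x, 1} (\<lambda>y. if y = x then 1 else 0)"
  interpret L: Vector_Spaces.linear "\<lambda>(q::rat) (y::real). of_rat q * y" "\<lambda>(q::rat) (y::real). of_rat q * y" \<phi>
    unfolding \<phi>_def by (rule VP.linear_construct[OF ind])
  show thesis
  proof (rule that)
    show "\<phi> (a + b) = \<phi> a + \<phi> b" for a b by (rule L.add)
    show "\<phi> (a * of_int z) = \<phi> a * of_int z" for z a
      using L.scale[of "of_int z" a] by (simp add: mult.commute)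
    show "\<phi> 1 = 0" "\<phi> x = 1"
      using VP.construct_basis[OF ind] \<open>x \<noteq> 1\<close> unfolding \<phi>_def by auto
  qed
qed

text \<open>Vieta's formula, needed to reach the sum of the roots through a coefficient. The guard
  \<open>F \<noteq> {}\<close> matters because \<open>card F - 1\<close> truncates at 0.\<close>

lemma coeff_prod_linear_factors:
  fixes F :: "'a::idom set"
  assumes "finite F"
  defines "p \<equiv> \<Prod>a\<in>F. [:- a, 1:]"
  shows "degree p = card F" "coeff p (card F) = 1" "F \<noteq> {} \<Longrightarrow> coeff p (card F - 1) = - \<Sum>F"
proof -
  have "degree (\<Prod>a\<in>F. [:- a, 1:]) = card F \<and> coeff (\<Prod>a\<in>F. [:- a, 1:]) (card F) = 1 \<and>
     (F \<noteq> {} \<longrightarrow> coeff (\<Prod>a\<in>F. [:- a, 1:]) (card F - 1) = - \<Sum>F)"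
    using assms(1)
  proof (induction F rule: finite_induct)
    case empty
    then show ?case by simp
  next
    case (insert a F)
    let ?q = "\<Prod>a\<in>F. [:- a, 1:]"
    have q: "?q \<noteq> 0" using insert by simp
    have d: "degree ([:-a,1:] * ?q) = Suc (card F)"
      using insert.IH q by (subst degree_mult_eq) auto
    have c: "coeff ([:-a,1:] * ?q) (Suc n) = coeff ?q n - a * coeff ?q (Suc n)" for n
      by (simp add: mult_pCons_left)
    have z: "coeff ?q (Suc (card F)) = 0"
      by (rule coeff_eq_0) (use insert.IH in simp)
    have "coeff ([:-a,1:] * ?q) (card F) = - (a + \<Sum>F)"
    proof (cases "F = {}")
      case False
      then obtain n where n: "card F = Suc n"
        using insert.hyps by (metis card_eq_0_iff not0_implies_Suc)
      show ?thesis using c[of n] insert.IH False unfolding n by simp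
    qed simp
    then show ?case using insert.hyps d c[of "card F"] z insert.IH by simp
  qed
  then show "degree p = card F" "coeff p (card F) = 1" "F \<noteq> {} \<Longrightarrow> coeff p (card F - 1) = - \<Sum>F"
    unfolding p_def by auto
qed

text \<open>In lowest terms every power of the denominator of \<open>x\<close> must divide the fixed
  nonzero integer \<open>c\<close>, so the denominator is 1.\<close>

lemma rat_integral_if_powers_bounded_denominator:
  fixes x c :: real
  assumes "x \<in> \<rat>" "c \<noteq> 0" "\<And>n. c * x ^ n \<in> \<int>"
  shows "x \<in> \<int>"
proof -
  obtain a b :: int where b: "b > 0" "coprime a b" and x: "x = of_int a / of_int b"
    using Rats_cases'[OF assms(1)] by blast
  obtain m :: int where m: "c = of_int m" using assms(3)[of 0] by (auto elim: Ints_cases)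
  have m0: "m \<noteq> 0" using assms(2) m by simp
  have dvd: "b ^ n dvd m" for n
  proof -
    obtain k :: int where "c * x ^ n = of_int k" using assms(3) by (auto elim: Ints_cases)
    then have "of_int (m * a ^ n) = (of_int (k * b ^ n) :: real)"
      using b(1) by (simp add: m x field_simps)
    then have "m * a ^ n = k * b ^ n" by (simp only: of_int_eq_iff)
    then have "b ^ n dvd m * a ^ n" by simp
    moreover have "coprime (b ^ n) (a ^ n)" using b(2) by (simp add: coprime_commute)
    ultimately show ?thesis by (metis coprime_dvd_mult_left_iff)
  qed
  have "b = 1"
  proof (rule ccontr)
    assume "b \<noteq> 1"
    then have "b \<ge> 2" using b by simp
    \<comment> \<open>Any exponent with \<open>2 ^ n\<close> above the absolute value of
      \<open>m\<close> would do.\<close>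
    define n where "n = nat \<bar>m\<bar>"
    have "\<bar>m\<bar> < 2 ^ n" unfolding n_def using less_exp[of "nat \<bar>m\<bar>"]
      by (metis abs_ge_zero nat_0_le of_nat_less_iff of_nat_numeral of_nat_power)
    also have "\<dots> \<le> b ^ n" using \<open>b \<ge> 2\<close> by (intro power_mono) auto
    finally show False using dvd_imp_le_int[OF m0 dvd[of n]] b by simp
  qed
  then show ?thesis using x by simp
qed

lemma common_denominator_of_rats:
  fixes X :: "real set"
  assumes "finite X" "X \<subseteq> \<rat>"
  obtains B :: int where "B > 0" "\<And>x. x \<in> X \<Longrightarrow> of_int B * x \<in> \<int>"
proof -
  have "\<exists>B::int. B > 0 \<and> (\<forall>x\<in>X. of_int B * x \<in> \<int>)"
    using assms
  proof (induction X rule: finite_induct)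
    case empty
    show ?case by (rule exI[of _ 1]) simp
  next
    case (insert x X)
    then obtain B :: int where B: "B > 0" "\<forall>x\<in>X. of_int B * x \<in> \<int>" by auto
    from insert.prems obtain a b :: int where b: "b > 0" "x = of_int a / of_int b"
      using Rats_cases'[of x] by blast
    have "of_int (B * b) * x = of_int (B * a)" using b by simp
    then have "of_int (B * b) * x \<in> \<int>" by (metis Ints_of_int)
    moreover have "of_int (B * b) * y \<in> \<int>" if "y \<in> X" for y
    proof -
      have "of_int b * (of_int B * y) \<in> \<int>" using B(2) that by (meson Ints_mult Ints_of_int)
      then show ?thesis by (simp add: mult_ac)
    qed
    ultimately show ?case using B b by (intro exI[of _ "B * b"]) auto
  qed
  then show thesis using that by blast
qed

lemma coeff_prod_linear_factors_in_Rats: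
  fixes F :: "real set"
  assumes "finite F" "F \<subseteq> \<rat>"
  shows "coeff (\<Prod>a\<in>F. [:- a, 1:]) n \<in> \<rat>"
  using assms
proof (induction F arbitrary: n rule: finite_induct)
  case (insert a F)
  then show ?case
    by (cases n) (auto simp: mult_pCons_left intro!: Rats_add Rats_mult Rats_diff)
next
  case empty
  then show ?case by (simp add: coeff_1)
qed

text \<open>Nodes \<open>\<theta> k\<close> carry weight vectors \<open>h k\<close>, with
  coordinates indexed by \<open>e\<close>. Nondegeneracy says that the coordinates together detect
  every function that is nonzero at some node. Several indices may share a node, as happens for the
  squared gaps.\<close>

locale integral_moments =
  fixes I :: "'k set" and \<theta> :: "'k \<Rightarrow> real" and h :: "'k \<Rightarrow> 'e \<Rightarrow> real"
  assumes finite_I: "finite I"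
    and integral: "(\<Sum>k\<in>I. \<theta> k ^ n * h k e) \<in> \<int>"
    and nondegenerate: "(\<And>e. (\<Sum>k\<in>I. \<alpha> (\<theta> k) * h k e) = 0) \<Longrightarrow> k \<in> I \<Longrightarrow> \<alpha> (\<theta> k) = 0"
begin

text \<open>A bound \<open>d\<close> in place of the degree lets a polynomial and its image under a
  coefficientwise map be expanded over the same range.\<close>

lemma poly_moment:
  assumes "degree p \<le> d"
  shows "(\<Sum>k\<in>I. poly p (\<theta> k) * h k e) = (\<Sum>n\<le>d. coeff p n * (\<Sum>k\<in>I. \<theta> k ^ n * h k e))"
proof -
  have "poly p x = (\<Sum>n\<le>d. coeff p n * x ^ n)" for x
    unfolding poly_altdef using assms
    by (intro sum.mono_neutral_left) (auto simp: coeff_eq_0)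
  then have "(\<Sum>k\<in>I. poly p (\<theta> k) * h k e) = (\<Sum>k\<in>I. \<Sum>n\<le>d. coeff p n * (\<theta> k ^ n * h k e))"
    by (simp add: sum_distrib_right mult.assoc)
  also have "\<dots> = (\<Sum>n\<le>d. \<Sum>k\<in>I. coeff p n * (\<theta> k ^ n * h k e))"
    by (rule sum.swap)
  finally show ?thesis by (simp add: sum_distrib_left)
qed

text \<open>
  A functional that kills 1 sends the monic polynomial vanishing at the nodes to one of smaller degree
  that still vanishes at them, hence to 0.
\<close>

lemma sum_nodes_in_Rats: "\<Sum>(\<theta> ` I) \<in> \<rat>"
proof (rule ccontr)
  define F where "F = \<theta> ` I"
  have fF: "finite F" using finite_I by (simp add: F_def)
  assume "\<Sum>(\<theta> ` I) \<notin> \<rat>"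
  then have nr: "\<Sum>F \<notin> \<rat>" by (simp add: F_def)
  then have "F \<noteq> {}" by auto
  obtain \<phi> :: "real \<Rightarrow> real" where \<phi>: "\<And>a b. \<phi> (a + b) = \<phi> a + \<phi> b"
    "\<And>z a. \<phi> (a * of_int z) = \<phi> a * of_int z" "\<phi> 1 = 0" "\<phi> (\<Sum>F) = 1"
    using irrational_separating_functional[OF nr] by blast
  have \<phi>0: "\<phi> 0 = 0" using \<phi>(2)[of 0 0] by simp
  have \<phi>m: "\<phi> (- x) = - \<phi> x" for x using \<phi>(1)[of x "-x"] \<phi>0 by simp
  have \<phi>sum: "\<phi> (sum f A) = (\<Sum>a\<in>A. \<phi> (f a))" for f and A :: "nat set"
    by (induction A rule: infinite_finite_induct) (auto simp: \<phi>0 \<phi>)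
  define p where "p = (\<Prod>a\<in>F. [:- a, 1:])"
  note cp = coeff_prod_linear_factors[OF fF, folded p_def]
  define q where "q = map_poly \<phi> p"
  have cq: "coeff q n = \<phi> (coeff p n)" for n
    unfolding q_def by (rule coeff_map_poly) (rule \<phi>0)
  have dq: "degree q \<le> card F"
    unfolding q_def using cp(1) map_poly_degree_leq[of \<phi> p] by simp
  have "(\<Sum>k\<in>I. poly q (\<theta> k) * h k e) = 0" for e
  proof -
    have "(\<Sum>k\<in>I. poly q (\<theta> k) * h k e)
        = (\<Sum>n\<le>card F. \<phi> (coeff p n * (\<Sum>k\<in>I. \<theta> k ^ n * h k e)))"
      unfolding poly_moment[OF dq] cq
    proof (intro sum.cong refl)
      fix n
      \<comment> \<open>The moment is an integer, so \<open>\<phi>\<close> can be moved across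
        it.\<close>
      obtain z :: int where z: "(\<Sum>k\<in>I. \<theta> k ^ n * h k e) = of_int z"
        using integral[of n e] by (elim Ints_cases)
      show "\<phi> (coeff p n) * (\<Sum>k\<in>I. \<theta> k ^ n * h k e) = \<phi> (coeff p n * (\<Sum>k\<in>I. \<theta> k ^ n * h k e))"
        unfolding z \<phi>(2) ..
    qed
    also have "\<dots> = \<phi> (\<Sum>k\<in>I. poly p (\<theta> k) * h k e)"
      using poly_moment[of p "card F"] cp(1) by (simp add: \<phi>sum)
    also have "(\<Sum>k\<in>I. poly p (\<theta> k) * h k e) = 0"
      by (rule sum.neutral) (use fF in \<open>auto simp: p_def poly_prod F_def\<close>)
    finally show ?thesis using \<phi>0 by simp
  qed
  then have "\<forall>k\<in>I. poly q (\<theta> k) = 0" using nondegenerate[of "poly q"] by blast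
  then have roots: "F \<subseteq> {x. poly q x = 0}" by (auto simp: F_def)
  have "q = 0"
  proof (rule ccontr)
    assume "q \<noteq> 0"
    moreover have "coeff q (card F) = 0" using cq cp(2) \<phi>(3) by simp
    ultimately have "degree q < card F" using dq
      by (metis leading_coeff_0_iff order_le_imp_less_or_eq)
    moreover have "card F \<le> degree q"
      using card_mono[OF poly_roots_finite[OF \<open>q \<noteq> 0\<close>] roots] card_poly_roots_bound[OF \<open>q \<noteq> 0\<close>] by simp
    ultimately show False by simp
  qed
  \<comment> \<open>The coefficient below the leading one is minus the sum of the nodes, which
    \<open>\<phi>\<close> was chosen not to kill.\<close>
  then have "\<phi> (- \<Sum>F) = 0" using cq[of "card F - 1"] cp(3)[OF \<open>F \<noteq> {}\<close>] by simp
  then show False using \<phi>m \<phi>(4) by simp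
qed

text \<open>A polynomial \<open>p\<close> vanishing at all other nodes isolates
  \<open>\<theta> k0\<close>: the moments of \<open>p\<close> times powers of the variable are a
  constant times the powers of \<open>\<theta> k0\<close>. After clearing the denominators of
  \<open>p\<close> they are integers, so the denominator of \<open>\<theta> k0\<close> is 1.\<close>

lemma rational_nodes_in_Ints:
  assumes rat: "\<And>k. k \<in> I \<Longrightarrow> \<theta> k \<in> \<rat>" and k0: "k0 \<in> I"
  shows "\<theta> k0 \<in> \<int>"
proof -
  define F where "F = \<theta> ` I - {\<theta> k0}"
  have F: "finite F" "F \<subseteq> \<rat>" using finite_I rat by (auto simp: F_def)
  define p where "p = (\<Prod>a\<in>F. [:- a, 1:])"
  have p0: "poly p (\<theta> k0) \<noteq> 0"
    using F by (auto simp: p_def poly_prod F_def)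
  have pk: "poly p (\<theta> k) = 0" if "k \<in> I" "\<theta> k \<noteq> \<theta> k0" for k
    using F that by (auto simp: p_def poly_prod F_def)
  \<comment> \<open>Nondegeneracy selects a coordinate in which the isolated node has nonzero total
    weight.\<close>
  have "\<exists>e. (\<Sum>k\<in>I. poly p (\<theta> k) * h k e) \<noteq> 0"
    using nondegenerate[of "poly p" k0] k0 p0 by blast
  then obtain e where e: "(\<Sum>k\<in>I. poly p (\<theta> k) * h k e) \<noteq> 0" by blast
  obtain B :: int where B: "B > 0" "\<And>x. x \<in> coeff p ` {..degree p} \<Longrightarrow> of_int B * x \<in> \<int>"
    by (rule common_denominator_of_rats[of "coeff p ` {..degree p}"])
      (use coeff_prod_linear_factors_in_Rats[OF F] in \<open>auto simp: p_def\<close>)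
  have cB: "of_int B * coeff p n \<in> \<int>" for n
    by (cases "n \<le> degree p") (use B(2) in \<open>auto simp: coeff_eq_0\<close>)
  let ?c = "of_int B * (\<Sum>k\<in>I. poly p (\<theta> k) * h k e)"
  have "?c * \<theta> k0 ^ n \<in> \<int>" for n
  proof -
    have "(\<Sum>k\<in>I. poly p (\<theta> k) * h k e) * \<theta> k0 ^ n = (\<Sum>k\<in>I. poly (monom 1 n * p) (\<theta> k) * h k e)"
      unfolding sum_distrib_right
    proof (rule sum.cong)
      show "poly p (\<theta> k) * h k e * \<theta> k0 ^ n = poly (monom 1 n * p) (\<theta> k) * h k e" if "k \<in> I" for k
        using pk[OF that] by (cases "\<theta> k = \<theta> k0") (auto simp: poly_monom)
    qed simp
    also have "\<dots> = (\<Sum>m\<le>degree (monom 1 n * p). coeff (monom 1 n * p) m * (\<Sum>k\<in>I. \<theta> k ^ m * h k e))"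
      by (rule poly_moment) simp
    finally have "?c * \<theta> k0 ^ n = (\<Sum>m\<le>degree (monom 1 n * p).
        (of_int B * coeff (monom 1 n * p) m) * (\<Sum>k\<in>I. \<theta> k ^ m * h k e))"
      by (simp add: mult.assoc sum_distrib_left[of "of_int B" _ "{..degree (monom 1 n * p)}"])
    also have "\<dots> \<in> \<int>"
    proof (rule Ints_sum)
      fix m
      have "of_int B * coeff (monom 1 n * p) m \<in> \<int>"
        using cB by (simp add: coeff_monom_mult)
      then show "of_int B * coeff (monom 1 n * p) m * (\<Sum>k\<in>I. \<theta> k ^ m * h k e) \<in> \<int>"
        by (rule Ints_mult) (rule integral)
    qed
    finally show ?thesis .
  qed
  then show ?thesis
    using rat_integral_if_powers_bounded_denominator[of "\<theta> k0" ?c] rat k0 e B(1) by auto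
qed

end

section \<open>Parity of power sums\<close>

text \<open>Passing from \<open>c n\<close> to \<open>c (Suc n) - t * c n\<close> multiplies the
  weights by \<open>\<theta> k - t\<close> and so removes the node \<open>t\<close>. For even
  \<open>t\<close> this does not change the parity of \<open>c (Suc n)\<close>. The weights are
  real, so evenness may fail for small \<open>n\<close>.\<close>

lemma eventually_even_power_sum:
  fixes c :: "nat \<Rightarrow> int" and h :: "'k \<Rightarrow> real"
  assumes "finite F" "\<And>n. of_int (c n) = (\<Sum>k\<in>I. of_int (\<theta> k) ^ n * h k)"
    "\<And>k. k \<in> I \<Longrightarrow> h k \<noteq> 0 \<Longrightarrow> \<theta> k \<in> F" "\<And>t. t \<in> F \<Longrightarrow> even t"
  shows "\<exists>N. \<forall>n\<ge>N. even (c n)"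
  using assms
proof (induction F arbitrary: c h rule: finite_induct)
  case empty
  have "of_int (c n) = (0::real)" for n
    unfolding empty(1) by (rule sum.neutral) (use empty in auto)
  then show ?case by auto
next
  case (insert t F)
  have "\<exists>N. \<forall>n\<ge>N. even (c (Suc n) - t * c n)"
  proof (rule insert.IH)
    show "of_int (c (Suc n) - t * c n) = (\<Sum>k\<in>I. of_int (\<theta> k) ^ n * (of_int (\<theta> k - t) * h k))" for n
      by (simp add: insert.prems(1) sum_distrib_left sum_subtractf[symmetric] algebra_simps)
    show "\<theta> k \<in> F" if "k \<in> I" "of_int (\<theta> k - t) * h k \<noteq> 0" for k
      using insert.prems(2)[of k] that by auto
  qed (use insert.prems in auto)
  then obtain N where "\<forall>n\<ge>N. even (c (Suc n) - t * c n)" ..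
  then have "even (c (Suc n))" if "n \<ge> N" for n
    using insert.prems(3)[of t] that by auto
  then have "\<forall>n\<ge>Suc N. even (c n)" by (metis Suc_le_D Suc_le_mono)
  then show ?case ..
qed

text \<open>The same removal of a node; for odd \<open>t\<close> it shows that the parity of
  \<open>c n\<close> is independent of \<open>n\<close>, so evenness travels back from large
  indices.\<close>

lemma even_power_sum_if_eventually_even:
  fixes c :: "nat \<Rightarrow> int" and h :: "'k \<Rightarrow> real"
  assumes "finite F" "\<And>n. of_int (c n) = (\<Sum>k\<in>I. of_int (\<theta> k) ^ n * h k)"
    "\<And>k. k \<in> I \<Longrightarrow> h k \<noteq> 0 \<Longrightarrow> \<theta> k \<in> F" "\<And>t. t \<in> F \<Longrightarrow> odd t"
    "\<And>n. n \<ge> N \<Longrightarrow> even (c n)"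
  shows "even (c n)"
  using assms
proof (induction F arbitrary: c h n rule: finite_induct)
  case empty
  have "of_int (c n) = (0::real)"
    unfolding empty(1) by (rule sum.neutral) (use empty in auto)
  then show ?case by simp
next
  case (insert t F)
  have "even (c (Suc n) - t * c n)" for n
  proof (rule insert.IH)
    show "of_int (c (Suc n) - t * c n) = (\<Sum>k\<in>I. of_int (\<theta> k) ^ n * (of_int (\<theta> k - t) * h k))" for n
      by (simp add: insert.prems(1) sum_distrib_left sum_subtractf[symmetric] algebra_simps)
    show "\<theta> k \<in> F" if "k \<in> I" "of_int (\<theta> k - t) * h k \<noteq> 0" for k
      using insert.prems(2)[of k] that by auto
  qed (use insert.prems in auto)
  then have step: "even (c n) \<longleftrightarrow> even (c (Suc n))" for n
    using insert.prems(3)[of t] by auto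
  have "even (c n) \<longleftrightarrow> even (c (n + m))" for m
    by (induction m) (use step in auto)
  then show ?case using insert.prems(4)[of "n + N"] by simp
qed

section \<open>Eigenvector decompositions of self-adjoint maps\<close>

text \<open>A maximiser \<open>x\<close> of the quadratic form on the unit sphere of
  \<open>V\<close> is an eigenvector: otherwise moving from \<open>x\<close> along the residual
  \<open>r\<close> would increase the Rayleigh quotient.\<close>

lemma selfadjoint_eigenvector_in_invariant_subspace:
  fixes f :: "'a::euclidean_space \<Rightarrow> 'a"
  assumes lin: "linear f" and sa: "\<And>x y. f x \<bullet> y = x \<bullet> f y"
    and V: "subspace V" "\<And>x. x \<in> V \<Longrightarrow> f x \<in> V" "V \<noteq> {0}"
  obtains v l where "v \<in> V" "v \<noteq> 0" "f v = l *\<^sub>R v"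
proof -
  define K where "K = V \<inter> sphere 0 1"
  have "compact K" unfolding K_def
    using closed_subspace[OF V(1)] by (intro closed_Int_compact) auto
  moreover have "K \<noteq> {}"
  proof -
    obtain v where "v \<in> V" "v \<noteq> 0" using V(3) subspace_0[OF V(1)] by blast
    then have "v /\<^sub>R norm v \<in> K" using V(1) by (simp add: K_def subspace_scale)
    then show ?thesis by blast
  qed
  moreover have "continuous_on K (\<lambda>x. x \<bullet> f x)"
    by (intro continuous_intros linear_continuous_on_compose[OF _ lin])
  ultimately obtain x where x: "x \<in> K" "\<And>y. y \<in> K \<Longrightarrow> y \<bullet> f y \<le> x \<bullet> f x"
    using continuous_attains_sup by metis
  define \<mu> where "\<mu> = x \<bullet> f x"
  have xV: "x \<in> V" and nx: "x \<bullet> x = 1" using x(1) by (auto simp: K_def norm_eq_1)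
  have le: "y \<bullet> f y \<le> \<mu> * (y \<bullet> y)" if "y \<in> V" for y
  proof (cases "y = 0")
    case False
    then have "y /\<^sub>R norm y \<in> K" using that V(1) by (simp add: K_def subspace_scale)
    then have "(y /\<^sub>R norm y) \<bullet> f (y /\<^sub>R norm y) \<le> \<mu>" unfolding \<mu>_def by (rule x(2))
    then have "(y \<bullet> f y) / (norm y * norm y) \<le> \<mu>"
      by (simp add: linear_cmul[OF lin] divide_simps)
    then show ?thesis using False
      by (simp add: divide_simps dot_square_norm power2_eq_square split: if_splits)
  qed (simp add: linear_0[OF lin])
  define r where "r = f x - \<mu> *\<^sub>R x"
  have rV: "r \<in> V" unfolding r_def using V xV by (simp add: subspace_diff subspace_scale)
  define C where "C = \<mu> * (r \<bullet> r) - r \<bullet> f r"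
  have quad: "2 * s * (r \<bullet> r) \<le> s\<^sup>2 * C" for s
  proof -
    have "(x + s *\<^sub>R r) \<bullet> f (x + s *\<^sub>R r) \<le> \<mu> * ((x + s *\<^sub>R r) \<bullet> (x + s *\<^sub>R r))"
      using V(1) xV rV by (intro le) (simp add: subspace_add subspace_scale)
    moreover have rx: "r \<bullet> f x = r \<bullet> r + \<mu> * (r \<bullet> x)"
    proof -
      have "r \<bullet> r = r \<bullet> f x - \<mu> * (r \<bullet> x)"
        by (subst (2) r_def) (simp add: inner_diff_right)
      then show ?thesis by simp
    qed
    moreover have "x \<bullet> f r = r \<bullet> r + \<mu> * (r \<bullet> x)" using sa rx by (metis inner_commute)
    ultimately show ?thesis unfolding C_def
      by (simp add: linear_add[OF lin] linear_cmul[OF lin] inner_add_left inner_add_right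
          nx \<mu>_def[symmetric] inner_commute[of x r] power2_eq_square algebra_simps)
  qed
  have "r \<bullet> r \<le> 0"
  proof (rule ccontr)
    assume "\<not> r \<bullet> r \<le> 0"
    then have p: "r \<bullet> r > 0" by linarith
    \<comment> \<open>Small enough that the linear term of \<open>quad\<close> beats the quadratic
      one; the summand 1 covers \<open>C = 0\<close>.\<close>
    define s where "s = (r \<bullet> r) / (\<bar>C\<bar> + 1)"
    have "s > 0" using p by (simp add: s_def)
    have "s * C \<le> s * (\<bar>C\<bar> + 1)" using \<open>s > 0\<close> by (intro mult_left_mono) auto
    also have "\<dots> = r \<bullet> r"
    proof -
      have "\<bar>C\<bar> + 1 \<noteq> 0" by linarith
      then show ?thesis by (simp add: s_def)
    qed
    finally have "s\<^sup>2 * C \<le> s * (r \<bullet> r)"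
      using \<open>s > 0\<close> by (simp add: power2_eq_square mult.assoc mult_left_mono)
    moreover have "s * (r \<bullet> r) > 0" using p \<open>s > 0\<close> by simp
    ultimately show False using quad[of s] by simp
  qed
  then have "r = 0" by (metis inner_ge_zero inner_eq_zero_iff antisym)
  then have "f x = \<mu> *\<^sub>R x" by (simp add: r_def)
  then show thesis using that xV nx by (metis inner_zero_left zero_neq_one)
qed

text \<open>The orthogonal complement of all eigenvectors is invariant. If nonzero it would contain
  an eigenvector, which is orthogonal to itself. Merging eigenvectors of equal eigenvalue lets
  \<open>S\<close> consist of the eigenvalues.\<close>

lemma selfadjoint_eigenvector_decomposition:
  fixes f :: "'a::euclidean_space \<Rightarrow> 'a"
  assumes lin: "linear f" and sa: "\<And>x y. f x \<bullet> y = x \<bullet> f y"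
  obtains S w where "finite S" "\<And>l. l \<in> S \<Longrightarrow> w l \<noteq> 0" "\<And>l. l \<in> S \<Longrightarrow> f (w l) = l *\<^sub>R w l"
    "v = (\<Sum>l\<in>S. w l)"
proof -
  define E where "E = {x. \<exists>l. f x = l *\<^sub>R x}"
  define V where "V = {x. \<forall>y\<in>E. y \<bullet> x = 0}"
  have "V = {0}"
  proof (rule ccontr)
    assume "V \<noteq> {0}"
    moreover have "subspace V" by (auto simp: V_def subspace_def inner_add_right)
    moreover have "f x \<in> V" if "x \<in> V" for x
    proof -
      have "y \<bullet> f x = 0" if yE: "y \<in> E" for y
      proof -
        obtain l where "f y = l *\<^sub>R y" using yE by (auto simp: E_def)
        then have "y \<bullet> f x = l * (y \<bullet> x)" by (metis sa inner_scaleR_left)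
        then show ?thesis using \<open>x \<in> V\<close> yE by (simp add: V_def)
      qed
      then show ?thesis by (simp add: V_def)
    qed
    ultimately obtain v l where "v \<in> V" "v \<noteq> 0" "f v = l *\<^sub>R v"
      using selfadjoint_eigenvector_in_invariant_subspace[OF lin sa] by blast
    then show False by (auto simp: V_def E_def)
  qed
  obtain y z where yz: "y \<in> span E" "\<And>w. w \<in> span E \<Longrightarrow> orthogonal z w" "v = y + z"
    using orthogonal_subspace_decomp_exists[of E v] by blast
  have "z \<in> V" using yz(2) span_base by (auto simp: V_def orthogonal_def inner_commute)
  then have "v \<in> span E" using yz \<open>V = {0}\<close> by auto
  then have "\<exists>w. finite {l. w l \<noteq> 0} \<and> (\<forall>l. f (w l) = l *\<^sub>R w l) \<and> v = (\<Sum>l | w l \<noteq> 0. w l)"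
  proof (induction v rule: span_induct_alt)
    case base
    show ?case by (rule exI[of _ "\<lambda>_. 0"]) (simp add: linear_0[OF lin])
  next
    case (step c x y)
    then obtain w where w: "finite {l. w l \<noteq> 0}" "\<forall>l. f (w l) = l *\<^sub>R w l" "y = (\<Sum>l | w l \<noteq> 0. w l)"
      by auto
    obtain m where m: "f x = m *\<^sub>R x" using step.hyps by (auto simp: E_def)
    define w' where "w' = w(m := c *\<^sub>R x + w m)"
    \<comment> \<open>The merged summand at \<open>m\<close> may cancel to 0, so both sums are taken
      over a set containing both supports.\<close>
    define A where "A = insert m {l. w l \<noteq> 0}"
    have A: "finite A" "{l. w' l \<noteq> 0} \<subseteq> A" "{l. w l \<noteq> 0} \<subseteq> A" "m \<in> A"
      using w(1) by (auto simp: A_def w'_def)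
    have "(\<Sum>l | w' l \<noteq> 0. w' l) = (\<Sum>l\<in>A. w' l)"
      using A by (intro sum.mono_neutral_left) auto
    also have "\<dots> = w' m + (\<Sum>l\<in>A - {m}. w' l)" using A by (rule_tac sum.remove)
    also have "(\<Sum>l\<in>A - {m}. w' l) = (\<Sum>l\<in>A - {m}. w l)" by (rule sum.cong) (auto simp: w'_def)
    also have "w' m = c *\<^sub>R x + w m" by (simp add: w'_def)
    also have "c *\<^sub>R x + w m + (\<Sum>l\<in>A - {m}. w l) = c *\<^sub>R x + (\<Sum>l\<in>A. w l)"
      using A by (simp add: sum.remove[of A m])
    also have "(\<Sum>l\<in>A. w l) = y" unfolding w(3)
      using A by (intro sum.mono_neutral_right) auto
    finally have "c *\<^sub>R x + y = (\<Sum>l | w' l \<noteq> 0. w' l)" by simp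
    moreover have "\<forall>l. f (w' l) = l *\<^sub>R w' l"
      using w(2) m by (auto simp: w'_def linear_add[OF lin] linear_cmul[OF lin] algebra_simps)
    moreover have "finite {l. w' l \<noteq> 0}" using A finite_subset by blast
    ultimately show ?case by blast
  qed
  then show thesis using that by auto
qed

section \<open>The matrix exponential and phases of eigenvectors\<close>

lemma matrix_power_mult_eigenvector:
  fixes M :: "complex ^ 'n ^ 'n"
  assumes "M *v x = c *s x"
  shows "matrix_power M k *v x = c ^ k *s x"
proof (induction k)
  case (Suc k)
  have "matrix_power M (Suc k) *v x = M *v (matrix_power M k *v x)"
    by (simp add: matrix_power_def matrix_vector_mul_assoc)
  also have "\<dots> = c ^ k *s (M *v x)" by (simp add: Suc vector_scalar_commute)
  finally show ?case by (simp add: assms mult.commute)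
qed (simp add: matrix_power_def)

definition complexify :: "real ^ 'n \<Rightarrow> complex ^ 'n" where
  "complexify x = (\<chi> u. of_real (x $ u))"

lemma complexify_sum: "complexify (\<Sum>l\<in>S. w l) = (\<Sum>l\<in>S. complexify (w l))"
  by (simp add: complexify_def vec_eq_iff)

lemma complexify_axis: "complexify (axis u 1) = axis u 1"
  by (simp add: complexify_def vec_eq_iff axis_def)

lemma selfadjoint_symmetric_matrix:
  fixes R :: "real ^ 'n::finite ^ 'n"
  assumes "\<And>u v. R $ u $ v = R $ v $ u"
  shows "(R *v x) \<bullet> y = x \<bullet> (R *v y)"
proof -
  have "transpose R = R" using assms by (simp add: transpose_def vec_eq_iff)
  then show ?thesis by (metis dot_lmul_matrix vector_transpose_matrix)
qed

text \<open>On an eigenvector the series is scalar. Entrywise reading of the infinite sum requires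
  convergence of all columns, hence the eigenvector decomposition of every basis vector and not only
  of \<open>axis i 1\<close>.\<close>

lemma matrix_exp_mult_axis:
  fixes R :: "real ^ 'n::finite ^ 'n"
  assumes sym: "\<And>u v. R $ u $ v = R $ v $ u"
    and w: "finite S" "\<And>l. l \<in> S \<Longrightarrow> R *v w l = l *\<^sub>R w l" "axis i 1 = (\<Sum>l\<in>S. w l)"
  shows "(matrix_exp (\<chi> u v. \<i> * of_real t * of_real (R $ u $ v)) *v axis i 1) $ v
    = (\<Sum>l\<in>S. cis (t * l) * of_real (w l $ v))"
proof -
  define M :: "complex ^ 'n ^ 'n" where "M = (\<chi> u v. \<i> * of_real t * of_real (R $ u $ v))"
  have M: "M *v complexify x = (\<i> * of_real (t * l)) *s complexify x" if "R *v x = l *\<^sub>R x" for x l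
  proof -
    have "(M *v complexify x) $ v = \<i> * of_real t * of_real ((R *v x) $ v)" for v
      by (simp add: M_def complexify_def matrix_vector_mult_def sum_distrib_left mult.assoc)
    then show ?thesis by (simp add: that vec_eq_iff complexify_def)
  qed
  have sums: "(\<lambda>k. (matrix_power M k /\<^sub>R fact k) $ v $ u) sums (\<Sum>l\<in>S. cis (t * l) * of_real (w l $ v))"
    if w: "finite S" "\<And>l. l \<in> S \<Longrightarrow> R *v w l = l *\<^sub>R w l" "axis u 1 = (\<Sum>l\<in>S. w l)" for S w u v
  proof -
    have "(matrix_power M k /\<^sub>R fact k) $ v $ u
        = (\<Sum>l\<in>S. ((\<i> * of_real (t * l)) ^ k /\<^sub>R fact k) * of_real (w l $ v))" for k
    proof -
      have "matrix_power M k $ v $ u = (matrix_power M k *v axis u 1) $ v"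
        by (simp add: matrix_vector_mult_def axis_def if_distrib cong: if_cong)
      also have "axis u 1 = (\<Sum>l\<in>S. complexify (w l))"
        using w(3) by (metis complexify_axis complexify_sum)
      also have "matrix_power M k *v \<dots> = (\<Sum>l\<in>S. (\<i> * of_real (t * l)) ^ k *s complexify (w l))"
        unfolding vec.sum[of "matrix_power M k"]
        by (rule sum.cong[OF refl]) (rule matrix_power_mult_eigenvector[OF M], rule w(2))
      finally show ?thesis by (simp add: complexify_def scaleR_sum_right mult.assoc)
    qed
    moreover have "(\<lambda>k. \<Sum>l\<in>S. ((\<i> * of_real (t * l)) ^ k /\<^sub>R fact k) * of_real (w l $ v))
        sums (\<Sum>l\<in>S. cis (t * l) * of_real (w l $ v))"
      unfolding cis_conv_exp by (intro sums_sum sums_mult2 exp_converges)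
    ultimately show ?thesis by simp
  qed
  have "(\<lambda>k. (matrix_power M k /\<^sub>R fact k) $ v $ u) sums (matrix_exp M $ v $ u)" for u v
  proof -
    have s: "summable (\<lambda>k. (matrix_power M k /\<^sub>R fact k) $ v $ u)" for u v
    proof -
      obtain S w where "finite S" "\<And>l. l \<in> S \<Longrightarrow> R *v w l = l *\<^sub>R w l" "axis u 1 = (\<Sum>l\<in>S. w l)"
        using selfadjoint_eigenvector_decomposition[of "(*v) R" "axis u 1"]
          selfadjoint_symmetric_matrix[of R] sym by (metis matrix_vector_mul_linear)
      then show ?thesis using sums sums_summable by blast
    qed
    have "(\<lambda>k. matrix_power M k /\<^sub>R fact k) sums (\<chi> v u. \<Sum>k. (matrix_power M k /\<^sub>R fact k) $ v $ u)"
      unfolding sums_def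
      by (intro vec_tendstoI) (use s in \<open>simp add: sums_def[symmetric] summable_sums sum_component del: vector_scaleR_component\<close>)
    then have "matrix_exp M = (\<chi> v u. \<Sum>k. (matrix_power M k /\<^sub>R fact k) $ v $ u)"
      unfolding matrix_exp_def by (rule sums_unique[symmetric])
    then show ?thesis using s summable_sums by auto
  qed
  then have "matrix_exp M $ v $ i = (\<Sum>l\<in>S. cis (t * l) * of_real (w l $ v))"
    using sums[OF w] sums_unique2 by blast
  then show ?thesis unfolding M_def[symmetric] by (simp add: matrix_vector_mult_def axis_def if_distrib cong: if_cong)
qed

lemma eigenvectors_orthogonal:
  fixes f :: "'a::real_inner \<Rightarrow> 'a"
  assumes "\<And>x y. f x \<bullet> y = x \<bullet> f y" "f x = l *\<^sub>R x" "f y = m *\<^sub>R y" "l \<noteq> m"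
  shows "x \<bullet> y = 0"
  using assms(1)[of x y] assms(2-4) by simp

text \<open>Pairing the transfer equation with \<open>w m\<close> gives
  \<open>\<gamma> * w m $ j = cis (t * m) * n m\<close>. Once \<open>\<gamma>\<close> has modulus 1,
  the real ratio of \<open>w m $ j\<close> to \<open>n m\<close> has modulus 1 and is a
  sign.\<close>

lemma state_transfer_eigenvector_decomposition:
  fixes R :: "real ^ 'n::finite ^ 'n"
  assumes sym: "\<And>u v. R $ u $ v = R $ v $ u"
    and transfer: "matrix_exp (\<chi> u v. \<i> * of_real t * of_real (R $ u $ v)) *v axis i 1 = \<gamma> *s axis j 1"
  obtains S w \<sigma> where "finite S" "\<And>l. l \<in> S \<Longrightarrow> w l \<noteq> 0" "\<And>l. l \<in> S \<Longrightarrow> R *v w l = l *\<^sub>R w l"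
    "(\<Sum>l\<in>S. w l) = axis i 1" "(\<Sum>l\<in>S. \<sigma> l *\<^sub>R w l) = axis j 1"
    "\<And>l. l \<in> S \<Longrightarrow> \<sigma> l = 1 \<or> \<sigma> l = -1" "\<And>l. l \<in> S \<Longrightarrow> cis (t * l) = of_real (\<sigma> l) * \<gamma>"
proof -
  note sa = selfadjoint_symmetric_matrix[of R, OF sym]
  obtain S w where S: "finite S" and w0: "\<And>l. l \<in> S \<Longrightarrow> w l \<noteq> 0"
    and w: "\<And>l. l \<in> S \<Longrightarrow> R *v w l = l *\<^sub>R w l" and e: "axis i 1 = (\<Sum>l\<in>S. w l)"
    using selfadjoint_eigenvector_decomposition[of "(*v) R" "axis i 1"] sa
      by (metis matrix_vector_mul_linear)
  have orth: "w l \<bullet> w m = 0" if "l \<in> S" "m \<in> S" "l \<noteq> m" for l m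
    using eigenvectors_orthogonal[of "(*v) R"] sa w that by metis
  define n where "n l = w l \<bullet> w l" for l
  have n: "n l > 0" if "l \<in> S" for l using w0[OF that] by (simp add: n_def)
  have wi: "w m $ i = n m" if "m \<in> S" for m
  proof -
    have "w m $ i = (\<Sum>l\<in>S. w m \<bullet> w l)"
      by (simp add: inner_sum_right[symmetric] e[symmetric] inner_axis)
    also have "\<dots> = (\<Sum>l\<in>S. if l = m then n m else 0)"
      by (rule sum.cong) (use orth that in \<open>auto simp: n_def\<close>)
    finally show ?thesis using S that by simp
  qed
  have sum_n: "(\<Sum>l\<in>S. n l) = 1"
  proof -
    have "(\<Sum>l\<in>S. n l) = (\<Sum>l\<in>S. w l) $ i" using wi by simp
    then show ?thesis by (simp add: e[symmetric])
  qed
  then have "S \<noteq> {}" by auto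
  have ej: "\<gamma> * axis j 1 $ v = (\<Sum>l\<in>S. cis (t * l) * of_real (w l $ v))" for v
    using matrix_exp_mult_axis[of R, OF sym S w e] transfer by (simp add: vec_eq_iff)
  have wj: "\<gamma> * of_real (w m $ j) = cis (t * m) * of_real (n m)" if "m \<in> S" for m
  proof -
    have "\<gamma> * of_real (w m $ j) = (\<Sum>v\<in>UNIV. (\<gamma> * axis j 1 $ v) * of_real (w m $ v))"
      by (simp add: axis_def if_distrib if_distribR cong: if_cong)
    also have "\<dots> = (\<Sum>v\<in>UNIV. \<Sum>l\<in>S. cis (t * l) * of_real (w l $ v * w m $ v))"
      unfolding ej by (simp add: sum_distrib_right mult.assoc)
    also have "\<dots> = (\<Sum>l\<in>S. \<Sum>v\<in>UNIV. cis (t * l) * of_real (w l $ v * w m $ v))"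
      by (rule sum.swap)
    also have "\<dots> = (\<Sum>l\<in>S. cis (t * l) * of_real (w l \<bullet> w m))"
      by (simp add: inner_vec_def sum_distrib_left)
    also have "\<dots> = (\<Sum>l\<in>S. if l = m then cis (t * m) * of_real (n m) else 0)"
      by (rule sum.cong) (use orth that in \<open>auto simp: n_def\<close>)
    finally show ?thesis using S that by simp
  qed
  have "\<gamma> \<noteq> 0" using wj n \<open>S \<noteq> {}\<close> by fastforce
  have norm_wj: "norm \<gamma> * \<bar>w m $ j\<bar> = n m" if "m \<in> S" for m
    using arg_cong[OF wj[OF that], of norm] n[OF that] by (simp add: norm_mult)
  define \<sigma> where "\<sigma> l = w l $ j / n l" for l
  have cis: "cis (t * l) = of_real (\<sigma> l) * \<gamma>" if "l \<in> S" for l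
    using wj[OF that] n[OF that] by (simp add: \<sigma>_def field_simps)
  have ej': "(\<Sum>l\<in>S. \<sigma> l *\<^sub>R w l) = axis j 1"
  proof -
    have "of_real ((\<Sum>l\<in>S. \<sigma> l *\<^sub>R w l) $ v) = (of_real (axis j 1 $ v) :: complex)" for v
    proof -
      have "\<gamma> * of_real (axis j 1 $ v) = \<gamma> * axis j 1 $ v" by (simp add: axis_def)
      also have "\<dots> = (\<Sum>l\<in>S. \<gamma> * of_real (\<sigma> l * w l $ v))"
        unfolding ej by (rule sum.cong) (auto simp: cis)
      also have "\<dots> = \<gamma> * of_real ((\<Sum>l\<in>S. \<sigma> l *\<^sub>R w l) $ v)"
        by (simp add: sum_distrib_left)
      finally show ?thesis using \<open>\<gamma> \<noteq> 0\<close> by simp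
    qed
    then show ?thesis by (simp only: of_real_eq_iff vec_eq_iff) simp
  qed
  \<comment> \<open>Norm preservation, obtained by scaling the entry at \<open>j\<close> of the
    expansion of \<open>axis j 1\<close> and comparing with \<open>sum_n\<close>.\<close>
  have "norm \<gamma> = 1"
  proof -
    have "1 = (\<Sum>l\<in>S. \<sigma> l *\<^sub>R w l) $ j" by (simp add: ej')
    then have "(norm \<gamma>)\<^sup>2 = (\<Sum>l\<in>S. (norm \<gamma>)\<^sup>2 * (\<sigma> l * w l $ j))" by (simp add: sum_distrib_left[symmetric])
    also have "\<dots> = (\<Sum>l\<in>S. n l)"
    proof (rule sum.cong)
      fix l assume l: "l \<in> S"
      have "(norm \<gamma>)\<^sup>2 * (\<sigma> l * w l $ j) = (norm \<gamma> * \<bar>w l $ j\<bar>)\<^sup>2 / n l"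
        by (simp add: \<sigma>_def power_mult_distrib power2_eq_square)
      then show "(norm \<gamma>)\<^sup>2 * (\<sigma> l * w l $ j) = n l"
        using norm_wj[OF l] n[OF l] by (simp add: power2_eq_square)
    qed simp
    finally show ?thesis using sum_n norm_ge_zero[of \<gamma>] by (auto simp: power2_eq_1_iff)
  qed
  then have "\<sigma> l = 1 \<or> \<sigma> l = -1" if "l \<in> S" for l
    using norm_wj[OF that] n[OF that] by (auto simp: \<sigma>_def abs_if field_simps split: if_splits)
  then show thesis using that S w0 w e[symmetric] ej' cis by blast
qed

section \<open>Signed decompositions of the two basis vectors\<close>

locale signed_eigenvector_decomposition =
  fixes R :: "real ^ 'v::finite ^ 'v" and i j :: 'v and S :: "real set"
    and w :: "real \<Rightarrow> real ^ 'v" and \<sigma> :: "real \<Rightarrow> real"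
  assumes sym: "R $ u $ v = R $ v $ u"
    and distinct: "i \<noteq> j"
    and finite_S: "finite S"
    and nonzero: "l \<in> S \<Longrightarrow> w l \<noteq> 0"
    and eigen: "l \<in> S \<Longrightarrow> R *v w l = l *\<^sub>R w l"
    and sum_w: "(\<Sum>l\<in>S. w l) = axis i 1"
    and sum_\<sigma>w: "(\<Sum>l\<in>S. \<sigma> l *\<^sub>R w l) = axis j 1"
    and sign: "l \<in> S \<Longrightarrow> \<sigma> l = 1 \<or> \<sigma> l = -1"
begin

definition "P = {l \<in> S. \<sigma> l = 1}"
definition "M = {l \<in> S. \<sigma> l = -1}"
text \<open>Orthogonality makes this squared norm also the entry of \<open>w l\<close> at
  \<open>i\<close>, and up to sign the entry at \<open>j\<close>.\<close>

definition "n l = w l \<bullet> w l"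

lemma P_sub: "l \<in> P \<Longrightarrow> l \<in> S" and M_sub: "l \<in> M \<Longrightarrow> l \<in> S"
  by (auto simp: P_def M_def)

lemma S_split: "S = P \<union> M" and PM_disjoint: "P \<inter> M = {}"
  using sign by (auto simp: P_def M_def)

lemma finite_PM [simp]: "finite P" "finite M"
  using finite_S by (auto simp: P_def M_def)

lemma sum_S: "(\<Sum>l\<in>S. f l) = (\<Sum>l\<in>P. f l) + (\<Sum>l\<in>M. f l)"
  by (subst S_split) (rule sum.union_disjoint, auto simp: PM_disjoint)

lemma n_pos: "l \<in> S \<Longrightarrow> n l > 0"
  using nonzero by (simp add: n_def)

lemma orth: "l \<in> S \<Longrightarrow> m \<in> S \<Longrightarrow> l \<noteq> m \<Longrightarrow> w l \<bullet> w m = 0"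
  using eigenvectors_orthogonal[of "(*v) R" "w l" l "w m" m] selfadjoint_symmetric_matrix[of R] sym eigen
  by metis

lemma inner_w: "l \<in> S \<Longrightarrow> m \<in> S \<Longrightarrow> w l \<bullet> w m = (if l = m then n l else 0)"
  using orth by (auto simp: n_def)

lemma w_i: assumes "l \<in> S" shows "w l $ i = n l"
proof -
  have "w l $ i = w l \<bullet> (\<Sum>m\<in>S. w m)" by (simp add: sum_w inner_axis)
  also have "\<dots> = (\<Sum>m\<in>S. if l = m then n l else 0)"
    unfolding inner_sum_right by (rule sum.cong) (auto simp: inner_w assms)
  finally show ?thesis using assms finite_S by simp
qed

lemma w_j: assumes "l \<in> S" shows "w l $ j = \<sigma> l * n l"
proof -
  have "w l $ j = w l \<bullet> (\<Sum>m\<in>S. \<sigma> m *\<^sub>R w m)" by (simp add: sum_\<sigma>w inner_axis)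
  also have "\<dots> = (\<Sum>m\<in>S. if l = m then \<sigma> l * n l else 0)"
    unfolding inner_sum_right by (rule sum.cong) (auto simp: inner_w assms)
  finally show ?thesis using assms finite_S by simp
qed

lemma sum_P: "2 *\<^sub>R (\<Sum>l\<in>P. w l) = axis i 1 + axis j 1"
  and sum_M: "2 *\<^sub>R (\<Sum>l\<in>M. w l) = axis i 1 - axis j 1"
proof -
  have "(\<Sum>l\<in>P. \<sigma> l *\<^sub>R w l) = (\<Sum>l\<in>P. w l)" "(\<Sum>l\<in>M. \<sigma> l *\<^sub>R w l) = (\<Sum>l\<in>M. - w l)"
    by (auto intro!: sum.cong simp: P_def M_def)
  then show "2 *\<^sub>R (\<Sum>l\<in>P. w l) = axis i 1 + axis j 1" "2 *\<^sub>R (\<Sum>l\<in>M. w l) = axis i 1 - axis j 1"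
    unfolding sum_w[symmetric] sum_\<sigma>w[symmetric] sum_S by (simp_all add: sum_negf scaleR_2)
qed

lemma sum_P_nth: "(\<Sum>l\<in>P. w l $ u) = (axis i 1 $ u + axis j 1 $ u) / 2"
  and sum_M_nth: "(\<Sum>l\<in>M. w l $ u) = (axis i 1 $ u - axis j 1 $ u) / 2"
  using arg_cong[OF sum_P, of "\<lambda>x. x $ u"] arg_cong[OF sum_M, of "\<lambda>x. x $ u"] by auto

lemma sum_n: "(\<Sum>l\<in>P. n l) = 1 / 2" "(\<Sum>l\<in>M. n l) = 1 / 2"
proof -
  have "(\<Sum>l\<in>P. n l) = (\<Sum>l\<in>P. w l $ i)" "(\<Sum>l\<in>M. n l) = (\<Sum>l\<in>M. w l $ i)"
    by (auto intro!: sum.cong simp: w_i P_sub M_sub)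
  then show "(\<Sum>l\<in>P. n l) = 1 / 2" "(\<Sum>l\<in>M. n l) = 1 / 2"
    using distinct by (simp_all add: sum_P_nth sum_M_nth axis_def)
qed

lemma P_nonempty: "P \<noteq> {}" and M_nonempty: "M \<noteq> {}"
  using sum_n by auto

end

section \<open>Integrality and parity of the squared gaps\<close>

text \<open>The binomial theorem reduces moments of differences to products of one-variable moments,
  whose integrality and parity are accessible.\<close>

lemma sum_power_diff_product:
  fixes f g :: "real \<Rightarrow> real"
  shows "(\<Sum>(l, m)\<in>A \<times> B. (l - m) ^ N * (f l * g m))
    = (\<Sum>r\<le>N. of_nat (N choose r) * (-1) ^ (N - r) * (\<Sum>l\<in>A. l ^ r * f l) * (\<Sum>m\<in>B. m ^ (N - r) * g m))"
proof -
  have pow: "(l - m) ^ N = (\<Sum>r\<le>N. of_nat (N choose r) * (-1) ^ (N - r) * l ^ r * m ^ (N - r))" for l m :: real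
    using binomial_ring[of l "- m" N] by (simp add: power_minus[of m] mult_ac)
  have "(l - m) ^ N * (f l * g m)
      = (\<Sum>r\<le>N. of_nat (N choose r) * (-1) ^ (N - r) * ((l ^ r * f l) * (m ^ (N - r) * g m)))" for l m
    unfolding pow sum_distrib_right by (rule sum.cong) (simp_all only: mult_ac)
  then have "(\<Sum>(l, m)\<in>A \<times> B. (l - m) ^ N * (f l * g m))
      = (\<Sum>(l, m)\<in>A \<times> B. \<Sum>r\<le>N. of_nat (N choose r) * (-1) ^ (N - r) * ((l ^ r * f l) * (m ^ (N - r) * g m)))"
    by simp
  also have "\<dots> = (\<Sum>r\<le>N. \<Sum>(l, m)\<in>A \<times> B. of_nat (N choose r) * (-1) ^ (N - r) * ((l ^ r * f l) * (m ^ (N - r) * g m)))"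
    unfolding case_prod_unfold by (rule sum.swap)
  also have "\<dots> = (\<Sum>r\<le>N. of_nat (N choose r) * (-1) ^ (N - r) *
      ((\<Sum>l\<in>A. l ^ r * f l) * (\<Sum>m\<in>B. m ^ (N - r) * g m)))"
    unfolding sum_product unfolding sum_distrib_left unfolding sum.cartesian_product ..
  finally show ?thesis by (simp only: mult.assoc)
qed

locale integral_signed_decomposition = signed_eigenvector_decomposition +
  fixes t :: real and \<gamma> :: complex
  assumes integral_entries: "R $ u $ v \<in> \<int>"
    and t_pos: "t > 0"
    and phase: "l \<in> S \<Longrightarrow> cis (t * l) = of_real (\<sigma> l) * \<gamma>"
begin

text \<open>Raising \<open>r\<close> by one applies the integer matrix \<open>R\<close> to the
  vector of moments.\<close>

lemma weighted_moment_integral: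
  assumes "\<And>u. (\<Sum>l\<in>S. c l * w l $ u) \<in> \<int>"
  shows "(\<Sum>l\<in>S. l ^ r * (c l * w l $ u)) \<in> \<int>"
proof (induction r arbitrary: u)
  case 0
  then show ?case using assms by simp
next
  case (Suc r)
  have "(\<Sum>l\<in>S. l ^ Suc r * (c l * w l $ u)) = (\<Sum>l\<in>S. l ^ r * (c l * (R *v w l) $ u))"
    by (rule sum.cong) (auto simp: eigen)
  also have "\<dots> = (\<Sum>l\<in>S. \<Sum>v\<in>UNIV. R $ u $ v * (l ^ r * (c l * w l $ v)))"
    by (simp add: matrix_vector_mult_def sum_distrib_left mult_ac)
  also have "\<dots> = (\<Sum>v\<in>UNIV. R $ u $ v * (\<Sum>l\<in>S. l ^ r * (c l * w l $ v)))"
    unfolding sum_distrib_left by (rule sum.swap)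
  also have "\<dots> \<in> \<int>" by (intro Ints_sum Ints_mult integral_entries Suc)
  finally show ?case .
qed

text \<open>The factor 2 clears the halves in the sums over \<open>P\<close> and \<open>M\<close>:
  these are the entries at \<open>u\<close> of the \<open>r\<close>-th power of \<open>R\<close>
  applied to \<open>axis i 1 + axis j 1\<close>, and for \<open>Y\<close> to the difference.\<close>

definition "X r u = (\<Sum>l\<in>P. l ^ r * (2 * w l $ u))"
definition "Y r u = (\<Sum>m\<in>M. m ^ r * (2 * w m $ u))"

text \<open>With \<open>E\<close> and \<open>F\<close> the entries of the power of \<open>R\<close>
  applied to \<open>axis i 1\<close> and \<open>axis j 1\<close>, \<open>X\<close> is
  \<open>E + F\<close> and \<open>Y\<close> is \<open>E - F\<close>.\<close>

lemma X_int: "X r u \<in> \<int>" and Y_int: "Y r u \<in> \<int>" and XY_parity: "(X r u - Y r u) / 2 \<in> \<int>"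
proof -
  define E where "E = (\<Sum>l\<in>S. l ^ r * (1 * w l $ u))"
  define F where "F = (\<Sum>l\<in>S. l ^ r * (\<sigma> l * w l $ u))"
  have ax: "axis a (1::real) $ v \<in> \<int>" for a v by (simp add: axis_def)
  have "(\<Sum>l\<in>S. 1 * w l $ v) = axis i 1 $ v" for v using sum_w by (simp flip: sum_component)
  then have E: "E \<in> \<int>" unfolding E_def by (intro weighted_moment_integral) (simp only: ax)
  have "(\<Sum>l\<in>S. \<sigma> l * w l $ v) = axis j 1 $ v" for v
    using arg_cong[OF sum_\<sigma>w, of "\<lambda>x. x $ v"] by simp
  then have F: "F \<in> \<int>" unfolding F_def by (intro weighted_moment_integral) (simp only: ax)
  have "(\<Sum>l\<in>P. l ^ r * (\<sigma> l * w l $ u)) = (\<Sum>l\<in>P. l ^ r * w l $ u)"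
    "(\<Sum>l\<in>M. l ^ r * (\<sigma> l * w l $ u)) = (\<Sum>l\<in>M. - (l ^ r * w l $ u))"
    by (auto intro!: sum.cong simp: P_def M_def)
  then have "X r u = E + F" "Y r u = E - F"
    unfolding X_def Y_def E_def F_def sum_S by (simp_all add: sum_negf sum_distrib_left[symmetric] mult.left_commute[of _ 2])
  then show "X r u \<in> \<int>" "Y r u \<in> \<int>" "(X r u - Y r u) / 2 \<in> \<int>" using E F by auto
qed

text \<open>Squares are used because the gaps themselves can be irrational: the path on three
  vertices has gap \<open>sqrt 2\<close>.\<close>

definition gap :: "real \<times> real \<Rightarrow> real" where "gap k = (fst k - snd k)\<^sup>2"
definition h :: "real \<times> real \<Rightarrow> 'a \<times> 'a \<Rightarrow> real" where
  "h k e = (2 * w (fst k) $ fst e) * (2 * w (snd k) $ snd e)"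

lemma moment_PM: "(\<Sum>k\<in>P \<times> M. gap k ^ r * h k e) = (\<Sum>s\<le>2 * r. of_nat (2 * r choose s) * (-1) ^ (2 * r - s) *
    X s (fst e) * Y (2 * r - s) (snd e))"
  using sum_power_diff_product[where N = "2 * r" and A = P and B = M and f = "\<lambda>l. 2 * w l $ fst e" and g = "\<lambda>m. 2 * w m $ snd e"]
  unfolding gap_def h_def X_def Y_def case_prod_unfold by (simp add: power_mult)

lemma moment_PP: "(\<Sum>k\<in>P \<times> P. gap k ^ r * h k e) = (\<Sum>s\<le>2 * r. of_nat (2 * r choose s) * (-1) ^ (2 * r - s) *
    X s (fst e) * X (2 * r - s) (snd e))"
  using sum_power_diff_product[where N = "2 * r" and A = P and B = P and f = "\<lambda>l. 2 * w l $ fst e" and g = "\<lambda>m. 2 * w m $ snd e"]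
  unfolding gap_def h_def X_def case_prod_unfold by (simp add: power_mult)

lemma moments_congruent:
  "((\<Sum>k\<in>P \<times> P. gap k ^ r * h k e) - (\<Sum>k\<in>P \<times> M. gap k ^ r * h k e)) / 2 \<in> \<int>"
proof -
  have "((\<Sum>k\<in>P \<times> P. gap k ^ r * h k e) - (\<Sum>k\<in>P \<times> M. gap k ^ r * h k e)) / 2
      = (\<Sum>s\<le>2 * r. of_nat (2 * r choose s) * (-1) ^ (2 * r - s) *
          X s (fst e) * ((X (2 * r - s) (snd e) - Y (2 * r - s) (snd e)) / 2))"
    unfolding moment_PM moment_PP sum_subtractf[symmetric] sum_divide_distrib
    by (rule sum.cong) (auto simp: field_simps)
  also have "\<dots> \<in> \<int>" by (intro Ints_sum Ints_mult X_int XY_parity) auto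
  finally show ?thesis .
qed

text \<open>Contracting both coordinates with \<open>w l\<close> and \<open>w m\<close> isolates the
  pair \<open>(l, m)\<close> by orthogonality.\<close>

lemma gap_nondegenerate:
  assumes AB: "A \<subseteq> S" "B \<subseteq> S" and z: "\<And>e. (\<Sum>k\<in>A \<times> B. \<alpha> (gap k) * h k e) = 0" and k: "k \<in> A \<times> B"
  shows "\<alpha> (gap k) = 0"
proof -
  obtain l m where lm: "k = (l, m)" "l \<in> S" "m \<in> S" "l \<in> A" "m \<in> B" using k AB by auto
  have fin: "finite A" "finite B" using AB finite_S finite_subset by auto
  have "0 = (\<Sum>u\<in>UNIV. \<Sum>v\<in>UNIV. (w l $ u * w m $ v) * (\<Sum>k\<in>A \<times> B. \<alpha> (gap k) * h k (u, v)))"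
    by (simp add: z)
  also have "\<dots> = (\<Sum>u\<in>UNIV. \<Sum>k\<in>A \<times> B. \<Sum>v\<in>UNIV. (w l $ u * w m $ v) * (\<alpha> (gap k) * h k (u, v)))"
    unfolding sum_distrib_left by (rule sum.cong[OF refl]) (rule sum.swap)
  also have "\<dots> = (\<Sum>k\<in>A \<times> B. \<Sum>u\<in>UNIV. \<Sum>v\<in>UNIV. (w l $ u * w m $ v) * (\<alpha> (gap k) * h k (u, v)))"
    by (rule sum.swap)
  also have "\<dots> = (\<Sum>k\<in>A \<times> B. 4 * \<alpha> (gap k) * ((w (fst k) \<bullet> w l) * (w (snd k) \<bullet> w m)))"
  proof (rule sum.cong[OF refl])
    fix k
    show "(\<Sum>u\<in>UNIV. \<Sum>v\<in>UNIV. (w l $ u * w m $ v) * (\<alpha> (gap k) * h k (u, v)))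
        = 4 * \<alpha> (gap k) * ((w (fst k) \<bullet> w l) * (w (snd k) \<bullet> w m))"
      unfolding inner_vec_def sum_product unfolding sum_distrib_left
      by (intro sum.cong refl) (simp add: h_def)
  qed
  also have "\<dots> = (\<Sum>k\<in>A \<times> B. if k = (l, m) then 4 * \<alpha> (gap (l, m)) * (n l * n m) else 0)"
    by (rule sum.cong) (use AB lm in \<open>auto simp: subset_iff inner_w split: if_splits\<close>)
  also have "\<dots> = 4 * \<alpha> (gap (l, m)) * (n l * n m)" using fin lm by (simp add: sum.delta)
  finally show ?thesis using n_pos[of l] n_pos[of m] lm by simp
qed

lemma integral_moments_PM: "integral_moments (P \<times> M) gap h"
proof
  show "(\<Sum>k\<in>P \<times> M. gap k ^ r * h k e) \<in> \<int>" for r e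
    unfolding moment_PM by (intro Ints_sum Ints_mult X_int Y_int) auto
  show "\<alpha> (gap k) = 0" if "\<And>e. (\<Sum>k\<in>P \<times> M. \<alpha> (gap k) * h k e) = 0" "k \<in> P \<times> M" for \<alpha> k
    using gap_nondegenerate[of P M \<alpha> k, OF _ _ that] P_sub M_sub by blast
qed simp

lemma integral_moments_PP: "integral_moments (P \<times> P) gap h"
proof
  show "(\<Sum>k\<in>P \<times> P. gap k ^ r * h k e) \<in> \<int>" for r e
    unfolding moment_PP by (intro Ints_sum Ints_mult X_int Y_int) auto
  show "\<alpha> (gap k) = 0" if "\<And>e. (\<Sum>k\<in>P \<times> P. \<alpha> (gap k) * h k e) = 0" "k \<in> P \<times> P" for \<alpha> k
    using gap_nondegenerate[of P P \<alpha> k, OF _ _ that] P_sub by blast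
qed simp

text \<open>Dividing the phases at \<open>l\<close> and \<open>m\<close> leaves the sign
  \<open>\<sigma> m\<close>, so \<open>t * (l - m)\<close> is a multiple of \<open>pi\<close> whose
  parity is that sign.\<close>

lemma gap_multiple:
  assumes "k \<in> P \<times> S"
  obtains z :: int where "gap k = (pi / t)\<^sup>2 * of_int (z\<^sup>2)" "odd z \<longleftrightarrow> k \<in> P \<times> M"
proof -
  obtain l m where k: "k = (l, m)" "l \<in> P" "m \<in> S" using assms by auto
  have "\<gamma> \<noteq> 0" using phase[of l] k P_sub by auto
  have "cis (t * (l - m)) = cis (t * l) / cis (t * m)" by (simp add: cis_divide right_diff_distrib)
  also have "cis (t * l) = \<gamma>" using phase[of l] k by (simp add: P_def)
  also have "cis (t * m) = of_real (\<sigma> m) * \<gamma>" using phase[of m] k by simp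
  also have "\<gamma> / (of_real (\<sigma> m) * \<gamma>) = of_real (\<sigma> m)"
    using sign[OF k(3)] \<open>\<gamma> \<noteq> 0\<close> by (elim disjE) simp_all
  finally have c: "cos (t * (l - m)) = \<sigma> m" "sin (t * (l - m)) = 0"
    by (simp_all add: complex_eq_iff)
  then obtain z :: int where z: "t * (l - m) = of_int z * pi" using sin_zero_iff_int2 by blast
  have "odd z \<longleftrightarrow> \<sigma> m = -1" using c(1) unfolding z by (auto simp: mult.commute[of _ pi] cos_npi_int)
  then have "odd z \<longleftrightarrow> k \<in> P \<times> M" using k by (auto simp: M_def)
  moreover have "l - m = pi / t * of_int z" using z t_pos by (simp add: field_simps)
  then have "gap k = (pi / t)\<^sup>2 * of_int (z\<^sup>2)" by (simp add: gap_def k power_mult_distrib power_divide)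
  ultimately show thesis using that by blast
qed

text \<open>The sum of the distinct gap values over \<open>P \<times> M\<close> is rational, and it
  is the unit times a positive integer because odd squares are positive.\<close>

lemma unit_gap_rational: "(pi / t)\<^sup>2 \<in> \<rat>"
proof -
  let ?D = "(pi / t)\<^sup>2"
  have "\<exists>z::int. z > 0 \<and> x = ?D * of_int z" if "x \<in> gap ` (P \<times> M)" for x
  proof -
    from that obtain k where k: "k \<in> P \<times> M" "x = gap k" by blast
    then have kS: "k \<in> P \<times> S" using M_sub by auto
    obtain z :: int where z: "gap k = ?D * of_int (z\<^sup>2)" "odd z \<longleftrightarrow> k \<in> P \<times> M"
      by (rule gap_multiple[OF kS])
    then have "odd z" using k by simp
    then have "z\<^sup>2 > 0" by (auto simp: zero_less_power2)
    then show ?thesis using z k by blast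
  qed
  then obtain f :: "real \<Rightarrow> int" where f: "\<And>x. x \<in> gap ` (P \<times> M) \<Longrightarrow> f x > 0 \<and> x = ?D * of_int (f x)"
    by metis
  have "\<Sum>(gap ` (P \<times> M)) = ?D * of_int (\<Sum>x\<in>gap ` (P \<times> M). f x)"
    using f by (simp add: sum_distrib_left)
  moreover have "(\<Sum>x\<in>gap ` (P \<times> M). f x) > 0"
    using f P_nonempty M_nonempty by (intro sum_pos) auto
  then have "(of_int (\<Sum>x\<in>gap ` (P \<times> M). f x) :: real) \<noteq> 0" by (simp only: of_int_eq_0_iff)
  ultimately have "?D = \<Sum>(gap ` (P \<times> M)) / of_int (\<Sum>x\<in>gap ` (P \<times> M). f x)"
    by (metis eq_divide_imp)
  then show ?thesis using integral_moments.sum_nodes_in_Rats[OF integral_moments_PM] by (metis Rats_divide Rats_of_int)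
qed

lemma gap_int: assumes "k \<in> P \<times> S" shows "gap k \<in> \<int>"
proof -
  have rat: "gap k \<in> \<rat>" if "k \<in> P \<times> S" for k
    using gap_multiple[OF that] unit_gap_rational by (metis Rats_mult Rats_of_int)
  consider "k \<in> P \<times> P" | "k \<in> P \<times> M" using assms S_split by auto
  then show ?thesis
  proof cases
    case 1
    show ?thesis
      by (rule integral_moments.rational_nodes_in_Ints[OF integral_moments_PP _ 1]) (use rat P_sub in auto)
  next
    case 2
    show ?thesis
      by (rule integral_moments.rational_nodes_in_Ints[OF integral_moments_PM _ 2]) (use rat M_sub in auto)
  qed
qed

text \<open>
  If some gap between \<open>P\<close> and \<open>M\<close> were odd, then all of them would be, while the gaps inside \<open>P\<close> are
  always even; but modulo 2 the moments over \<open>P \<times> M\<close> and \<open>P \<times> P\<close> agree, and at \<open>(i, i)\<close> the zeroth is 1.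
\<close>

lemma gap_even:
  assumes k0: "k0 \<in> P \<times> M"
  shows "even \<lfloor>gap k0\<rfloor>"
proof (rule ccontr)
  assume odd0: "odd \<lfloor>gap k0\<rfloor>"
  obtain a b :: int where b: "b > 0" "coprime a b" and D: "(pi / t)\<^sup>2 = of_int a / of_int b"
    using Rats_cases'[OF unit_gap_rational] by blast
  have gapz: "\<exists>z::int. \<lfloor>gap k\<rfloor> * b = a * z\<^sup>2 \<and> (odd z \<longleftrightarrow> k \<in> P \<times> M)" if k: "k \<in> P \<times> S" for k
  proof -
    obtain z :: int where z: "gap k = (pi / t)\<^sup>2 * of_int (z\<^sup>2)" "odd z \<longleftrightarrow> k \<in> P \<times> M"
      using gap_multiple[OF k] by blast
    have "of_int \<lfloor>gap k\<rfloor> = gap k" using gap_int[OF k] by (auto elim: Ints_cases)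
    moreover have "gap k * of_int b = of_int a * of_int (z\<^sup>2)"
      using z(1) b(1) unfolding D by (simp add: field_simps)
    ultimately have "of_int (\<lfloor>gap k\<rfloor> * b) = (of_int (a * z\<^sup>2) :: real)"
      by (simp only: of_int_mult)
    then have "\<lfloor>gap k\<rfloor> * b = a * z\<^sup>2" by (simp only: of_int_eq_iff)
    then show ?thesis using z(2) by blast
  qed
  \<comment> \<open>With \<open>b\<close> even, \<open>a\<close> would be odd, and for odd
    \<open>z\<close> the two sides of the identity in \<open>gapz\<close> would differ in
    parity.\<close>
  have "odd b"
  proof
    assume "even b"
    then have "odd a" using b(2) by (metis coprime_common_divisor odd_one)
    obtain z :: int where "\<lfloor>gap k0\<rfloor> * b = a * z\<^sup>2" "odd z" using gapz[of k0] k0 M_sub by auto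
    then show False using \<open>even b\<close> \<open>odd a\<close> by (metis even_mult_iff even_power)
  qed
  obtain z0 :: int where "\<lfloor>gap k0\<rfloor> * b = a * z0\<^sup>2" "odd z0" using gapz[of k0] k0 M_sub by auto
  then have "odd a" using odd0 \<open>odd b\<close> by (metis even_mult_iff)
  have odd_PM: "odd \<lfloor>gap k\<rfloor>" if k: "k \<in> P \<times> M" for k
  proof -
    obtain z :: int where "\<lfloor>gap k\<rfloor> * b = a * z\<^sup>2" "odd z" using gapz[of k] k M_sub by auto
    then show ?thesis using \<open>odd a\<close> by (metis even_mult_iff even_power)
  qed
  have even_PP: "even \<lfloor>gap k\<rfloor>" if k: "k \<in> P \<times> P" for k
  proof -
    have "k \<notin> P \<times> M" using k PM_disjoint by auto
    then obtain z :: int where "\<lfloor>gap k\<rfloor> * b = a * z\<^sup>2" "even z" using gapz[of k] k P_sub by auto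
    then show ?thesis using \<open>odd b\<close> by (metis even_mult_iff even_power zero_less_numeral)
  qed
  define c where "c r = \<lfloor>\<Sum>k\<in>P \<times> M. gap k ^ r * h k (i, i)\<rfloor>" for r
  define c' where "c' r = \<lfloor>\<Sum>k\<in>P \<times> P. gap k ^ r * h k (i, i)\<rfloor>" for r
  have fl: "of_int \<lfloor>x\<rfloor> = x" if "x \<in> \<int>" for x :: real using that by (auto elim: Ints_cases)
  have c: "of_int (c r) = (\<Sum>k\<in>P \<times> M. gap k ^ r * h k (i, i))"
    and c': "of_int (c' r) = (\<Sum>k\<in>P \<times> P. gap k ^ r * h k (i, i))" for r
    unfolding c_def c'_def
    using integral_moments.integral[OF integral_moments_PM] integral_moments.integral[OF integral_moments_PP]
    by (simp_all add: fl)
  have cong: "even (c' r - c r)" for r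
  proof -
    have "(of_int (c' r) - of_int (c r)) / (2::real) \<in> \<int>" unfolding c c' by (rule moments_congruent)
    then obtain z :: int where "(of_int (c' r) - of_int (c r)) / (2::real) = of_int z" by (auto elim: Ints_cases)
    then have "of_int (c' r - c r) = (of_int (2 * z) :: real)" by simp
    then have "c' r - c r = 2 * z" by (simp only: of_int_eq_iff)
    then show ?thesis by simp
  qed
  \<comment> \<open>Even nodes make the moments over \<open>P \<times> P\<close> even for large
    \<open>r\<close>; the congruence carries this to \<open>P \<times> M\<close>, where odd nodes
    bring it back to \<open>r = 0\<close>.\<close>
  have "\<exists>N. \<forall>r\<ge>N. even (c' r)"
  proof (rule eventually_even_power_sum)
    show "of_int (c' r) = (\<Sum>k\<in>P \<times> P. of_int \<lfloor>gap k\<rfloor> ^ r * h k (i, i))" for r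
      unfolding c' by (rule sum.cong) (use gap_int P_sub in \<open>auto simp: fl\<close>)
    show "finite ((\<lambda>k. \<lfloor>gap k\<rfloor>) ` (P \<times> P))" by simp
  qed (use even_PP in auto)
  then obtain N where N: "\<And>r. r \<ge> N \<Longrightarrow> even (c' r)" by blast
  have "even (c 0)"
  proof (rule even_power_sum_if_eventually_even)
    show "of_int (c r) = (\<Sum>k\<in>P \<times> M. of_int \<lfloor>gap k\<rfloor> ^ r * h k (i, i))" for r
      unfolding c by (rule sum.cong) (use gap_int M_sub in \<open>auto simp: fl\<close>)
    show "even (c r)" if "r \<ge> N" for r using N[OF that] cong[of r] by simp
    show "finite ((\<lambda>k. \<lfloor>gap k\<rfloor>) ` (P \<times> M))" by simp
  qed (use odd_PM in auto)
  moreover have "c 0 = 1"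
  proof -
    have "of_int (c 0) = (\<Sum>l\<in>P. \<Sum>m\<in>M. (2 * n l) * (2 * n m))"
      unfolding c sum.cartesian_product
      by (rule sum.cong) (auto simp: h_def w_i P_sub M_sub)
    also have "\<dots> = (2 * (\<Sum>l\<in>P. n l)) * (2 * (\<Sum>m\<in>M. n m))"
      unfolding sum_product[symmetric] by (simp only: sum_distrib_left)
    finally show ?thesis by (simp add: sum_n)
  qed
  ultimately show False by simp
qed

lemma gap_ge_2:
  assumes "l \<in> P" "m \<in> M"
  shows "(l - m)\<^sup>2 \<ge> 2"
proof -
  have "gap (l, m) = of_int \<lfloor>gap (l, m)\<rfloor>" using gap_int[of "(l, m)"] assms M_sub by (auto elim: Ints_cases)
  moreover have "gap (l, m) > 0" using assms PM_disjoint by (auto simp: gap_def)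
  ultimately have "\<lfloor>gap (l, m)\<rfloor> > 0" by linarith
  then have "\<lfloor>gap (l, m)\<rfloor> \<ge> 2" using gap_even[of "(l, m)"] assms by (intro zdvd_imp_le) auto
  then show ?thesis by (simp add: gap_def le_floor_iff)
qed

end

section \<open>Spectral consequences of a bridge\<close>

text \<open>\<open>C\<close> is the side of the bridge containing \<open>i\<close>. The case
  \<open>i' = j\<close> is included.\<close>

locale bridge_state_transfer = integral_signed_decomposition R i j S w \<sigma> t \<gamma>
  for R :: "real ^ 'v::finite ^ 'v" and i j S w \<sigma> t \<gamma> +
  fixes C :: "'v set" and i' :: 'v
  assumes i_C: "i \<in> C" and j_C: "j \<notin> C" and i'_C: "i' \<notin> C"
    and bridge: "u \<in> C \<Longrightarrow> v \<notin> C \<Longrightarrow> R $ u $ v = (if u = i \<and> v = i' then 1 else 0)"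
begin

definition g :: "real \<Rightarrow> real \<Rightarrow> real" where "g l m = (\<Sum>u\<in>C. w l $ u * w m $ u)"

text \<open>The commutator of \<open>R\<close> with the projection onto \<open>C\<close> is supported on the bridge.\<close>

lemma gap_times_g:
  assumes "l \<in> S" "m \<in> S"
  shows "(l - m) * g l m = w l $ i' * n m - n l * w m $ i'"
proof -
  \<comment> \<open>The part of the form of \<open>R\<close> inside \<open>C\<close>; being
    symmetric, it cancels when \<open>l\<close> and \<open>m\<close> are exchanged and the results
    subtracted.\<close>
  define T where "T l m = (\<Sum>u\<in>C. \<Sum>v\<in>C. R $ u $ v * w l $ v * w m $ u)" for l m
  have T_sym: "T l m = T m l" for l m
    unfolding T_def by (subst sum.swap) (simp add: sym mult_ac)
  have "l * g l m = T l m + w l $ i' * n m" if l: "l \<in> S" and m: "m \<in> S" for l m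
  proof -
    have "l * g l m = (\<Sum>u\<in>C. (R *v w l) $ u * w m $ u)"
      by (simp add: g_def eigen[OF l] sum_distrib_left mult.assoc)
    also have "\<dots> = (\<Sum>u\<in>C. (\<Sum>v\<in>C. R $ u $ v * w l $ v * w m $ u) + (\<Sum>v\<in>- C. R $ u $ v * w l $ v * w m $ u))"
    proof (rule sum.cong[OF refl])
      fix u
      have "(\<Sum>v\<in>UNIV. R $ u $ v * w l $ v * w m $ u)
          = (\<Sum>v\<in>C. R $ u $ v * w l $ v * w m $ u) + (\<Sum>v\<in>- C. R $ u $ v * w l $ v * w m $ u)"
        by (subst sum.union_disjoint[symmetric]) auto
      then show "(R *v w l) $ u * w m $ u
          = (\<Sum>v\<in>C. R $ u $ v * w l $ v * w m $ u) + (\<Sum>v\<in>- C. R $ u $ v * w l $ v * w m $ u)"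
        by (simp add: matrix_vector_mult_def sum_distrib_right)
    qed
    also have "\<dots> = T l m + (\<Sum>u\<in>C. \<Sum>v\<in>- C. R $ u $ v * w l $ v * w m $ u)"
      by (simp add: T_def sum.distrib)
    also have "(\<Sum>u\<in>C. \<Sum>v\<in>- C. R $ u $ v * w l $ v * w m $ u)
        = (\<Sum>u\<in>C. \<Sum>v\<in>- C. if v = i' then (if u = i then w l $ i' * w m $ i else 0) else 0)"
      by (intro sum.cong refl) (auto simp: bridge)
    also have "\<dots> = w l $ i' * n m" using i_C i'_C by (simp add: w_i[OF m])
    finally show ?thesis .
  qed
  from this[OF assms] this[OF assms(2,1)] have "l * g l m - m * g m l = w l $ i' * n m - n l * w m $ i'"
    by (simp add: T_sym[of m l])
  moreover have "g m l = g l m" by (simp add: g_def mult.commute)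
  ultimately show ?thesis by (simp add: algebra_simps)
qed

text \<open>Since \<open>j\<close> lies outside \<open>C\<close>, the sum of the \<open>w m\<close>
  restricts on \<open>C\<close> to half of \<open>axis i 1\<close>.\<close>

lemma sum_M_g: assumes "l \<in> S" shows "(\<Sum>m\<in>M. g l m) = n l / 2"
proof -
  have "(\<Sum>m\<in>M. g l m) = (\<Sum>u\<in>C. w l $ u * (\<Sum>m\<in>M. w m $ u))"
    unfolding g_def sum_distrib_left by (rule sum.swap)
  also have "\<dots> = (\<Sum>u\<in>C. if u = i then w l $ i / 2 else 0)"
    by (rule sum.cong) (use j_C distinct in \<open>auto simp: sum_M_nth axis_def\<close>)
  finally show ?thesis using i_C by (simp add: w_i[OF assms])
qed

lemma sum_P_g: assumes "m \<in> S" shows "(\<Sum>l\<in>P. g l m) = n m / 2"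
proof -
  have "(\<Sum>l\<in>P. g l m) = (\<Sum>u\<in>C. (\<Sum>l\<in>P. w l $ u) * w m $ u)"
    unfolding g_def sum_distrib_right by (rule sum.swap)
  also have "\<dots> = (\<Sum>u\<in>C. if u = i then w m $ i / 2 else 0)"
    by (rule sum.cong) (use j_C distinct in \<open>auto simp: sum_P_nth axis_def\<close>)
  finally show ?thesis using i_C by (simp add: w_i[OF assms])
qed

text \<open>Divided by their norms the \<open>w l\<close> are orthonormal; \<open>y\<close> is the
  projection of \<open>axis u 1\<close> onto their span.\<close>

lemma bessel: "(\<Sum>l\<in>S. (w l $ u)\<^sup>2 / n l) \<le> 1"
proof -
  define y where "y = (\<Sum>l\<in>S. (w l $ u / n l) *\<^sub>R w l)"
  have 1: "axis u 1 \<bullet> y = (\<Sum>l\<in>S. (w l $ u)\<^sup>2 / n l)"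
    unfolding y_def inner_sum_right
    by (rule sum.cong) (simp_all add: inner_axis inner_commute[of "axis u 1"] power2_eq_square)
  have "w l \<bullet> y = w l $ u" if l: "l \<in> S" for l
  proof -
    have "w l \<bullet> y = (\<Sum>m\<in>S. if l = m then w l $ u else 0)"
      unfolding y_def inner_sum_right
      by (rule sum.cong) (use n_pos[OF l] in \<open>auto simp: inner_w l\<close>)
    then show ?thesis using l finite_S by simp
  qed
  moreover have "y \<bullet> x = (\<Sum>l\<in>S. (w l $ u / n l) * (w l \<bullet> x))" for x
    by (simp add: y_def inner_sum_left)
  ultimately have "y \<bullet> y = (\<Sum>l\<in>S. (w l $ u / n l) * w l $ u)" by simp
  also have "\<dots> = (\<Sum>l\<in>S. (w l $ u)\<^sup>2 / n l)" by (simp add: power2_eq_square)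
  finally have 2: "y \<bullet> y = (\<Sum>l\<in>S. (w l $ u)\<^sup>2 / n l)" .
  have "0 \<le> (axis u 1 - y) \<bullet> (axis u 1 - y)" by simp
  also have "\<dots> = 1 - (\<Sum>l\<in>S. (w l $ u)\<^sup>2 / n l)"
    by (simp add: inner_diff_left inner_diff_right 1 2 inner_commute[of y "axis u 1"] inner_axis_axis)
  finally show ?thesis by simp
qed

text \<open>
  Both terms of \<open>F\<close> below are nonnegative, because squared gaps are at least 2, while \<open>F\<close> sums to at most 0
  by Bessel's inequality at \<open>i'\<close>.
\<close>

lemma gap_eq_2_if_nonadjacent:
  assumes "i' \<noteq> j" and lm: "l \<in> P" "m \<in> M"
  shows "(l - m)\<^sup>2 = 2"
proof -
  \<comment> \<open>With \<open>N = n l * n m\<close>, the numerators combine to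
    \<open>((l - m) * g l m)\<^sup>2 - 4 * g l m * N + 2 * N\<^sup>2\<close>, from which
    \<open>gap_times_g\<close> eliminates the gap.\<close>
  define F where "F l m = ((l - m)\<^sup>2 - 2) * (g l m)\<^sup>2 / (n l * n m) + 2 * ((g l m - n l * n m)\<^sup>2 / (n l * n m))" for l m
  have i'_i: "i' \<noteq> i" using i_C i'_C by auto
  have pos: "n l > 0" "n m > 0" if "l \<in> P" "m \<in> M" for l m
    using that n_pos P_sub M_sub by auto
  have nonneg: "((l - m)\<^sup>2 - 2) * (g l m)\<^sup>2 / (n l * n m) \<ge> 0" "2 * ((g l m - n l * n m)\<^sup>2 / (n l * n m)) \<ge> 0"
    if "l \<in> P" "m \<in> M" for l m
    using gap_ge_2[OF that] pos[OF that] by auto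
  have F_eq: "F l m = (w l $ i')\<^sup>2 / n l * n m - 2 * (w l $ i' * w m $ i') + n l * ((w m $ i')\<^sup>2 / n m)
      - 4 * g l m + 2 * (n l * n m)" if "l \<in> P" "m \<in> M" for l m
  proof -
    let ?N = "n l * n m"
    let ?rhs = "(w l $ i')\<^sup>2 / n l * n m - 2 * (w l $ i' * w m $ i') + n l * ((w m $ i')\<^sup>2 / n m)
      - 4 * g l m + 2 * ?N"
    have N: "?N \<noteq> 0" using pos[OF that] by simp
    then have "F l m * ?N = ((l - m)\<^sup>2 - 2) * (g l m)\<^sup>2 + 2 * (g l m - ?N)\<^sup>2"
      by (simp add: F_def distrib_right)
    also have "\<dots> = ((l - m) * g l m)\<^sup>2 - 4 * g l m * ?N + 2 * ?N\<^sup>2"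
      by (simp add: power2_eq_square algebra_simps)
    also have "(l - m) * g l m = w l $ i' * n m - n l * w m $ i'"
      using gap_times_g that P_sub M_sub by simp
    also have "(w l $ i' * n m - n l * w m $ i')\<^sup>2 - 4 * g l m * ?N + 2 * ?N\<^sup>2 = ?rhs * ?N"
      using pos[OF that] by (simp add: divide_simps) (simp add: power2_eq_square algebra_simps)
    finally show ?thesis by (rule mult_right_cancel[OF N, THEN iffD1])
  qed
  \<comment> \<open>Here \<open>i' \<noteq> j\<close> enters: \<open>axis i 1 + axis j 1\<close>
    vanishes at \<open>i'\<close>, which removes the mixed term.\<close>
  have wP: "(\<Sum>l\<in>P. w l $ i') = 0"
    using i'_i assms(1) by (simp add: sum_P_nth axis_def)
  have "(\<Sum>l\<in>P. \<Sum>m\<in>M. F l m) = (\<Sum>l\<in>P. \<Sum>m\<in>M. (w l $ i')\<^sup>2 / n l * n m)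
      - 2 * (\<Sum>l\<in>P. \<Sum>m\<in>M. w l $ i' * w m $ i') + (\<Sum>l\<in>P. \<Sum>m\<in>M. n l * ((w m $ i')\<^sup>2 / n m))
      - 4 * (\<Sum>l\<in>P. \<Sum>m\<in>M. g l m) + 2 * (\<Sum>l\<in>P. \<Sum>m\<in>M. n l * n m)"
    by (simp add: F_eq sum.distrib sum_subtractf sum_distrib_left)
  also have "(\<Sum>l\<in>P. \<Sum>m\<in>M. (w l $ i')\<^sup>2 / n l * n m) = (\<Sum>l\<in>P. (w l $ i')\<^sup>2 / n l) / 2"
    unfolding sum_product[symmetric] by (simp add: sum_n)
  also have "(\<Sum>l\<in>P. \<Sum>m\<in>M. w l $ i' * w m $ i') = 0"
    unfolding sum_product[symmetric] by (simp add: wP)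
  also have "(\<Sum>l\<in>P. \<Sum>m\<in>M. n l * ((w m $ i')\<^sup>2 / n m)) = (\<Sum>m\<in>M. (w m $ i')\<^sup>2 / n m) / 2"
    unfolding sum_product[symmetric] by (simp add: sum_n)
  also have "(\<Sum>l\<in>P. \<Sum>m\<in>M. g l m) = 1 / 4"
    by (simp add: sum_M_g P_sub sum_divide_distrib[symmetric] sum_n)
  also have "(\<Sum>l\<in>P. \<Sum>m\<in>M. n l * n m) = 1 / 4"
    unfolding sum_product[symmetric] by (simp add: sum_n)
  finally have "(\<Sum>l\<in>P. \<Sum>m\<in>M. F l m) = (\<Sum>l\<in>S. (w l $ i')\<^sup>2 / n l) / 2 - 1 / 2"
    unfolding sum_S by (simp add: add_divide_distrib)
  then have "(\<Sum>l\<in>P. \<Sum>m\<in>M. F l m) \<le> 0" using bessel[of i'] by simp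
  moreover have F0: "F l m \<ge> 0" if "l \<in> P" "m \<in> M" for l m
    unfolding F_def using nonneg[OF that] by (rule add_nonneg_nonneg)
  ultimately have "(\<Sum>l\<in>P. \<Sum>m\<in>M. F l m) = 0" by (simp add: sum_nonneg order_antisym)
  then have "(\<Sum>m\<in>M. F l m) = 0"
    using lm F0 by (subst (asm) sum_nonneg_eq_0_iff) (auto intro: sum_nonneg)
  then have "F l m = 0" using lm F0 by (subst (asm) sum_nonneg_eq_0_iff) auto
  then have "((l - m)\<^sup>2 - 2) * (g l m)\<^sup>2 / (n l * n m) = 0" "(g l m - n l * n m)\<^sup>2 / (n l * n m) = 0"
    using nonneg[OF lm] unfolding F_def by linarith+
  \<comment> \<open>The second equation makes \<open>g l m\<close> equal to the positive
    \<open>n l * n m\<close>, so the first forces the gap.\<close>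
  then show ?thesis using pos[OF lm] by auto
qed

text \<open>For \<open>i' = j\<close> the entries at \<open>i'\<close> are known up to sign from
  \<open>n\<close>, so the commutator identity gives \<open>g\<close> explicitly, and the known sums
  of \<open>g\<close> become these identities.\<close>

lemma
  assumes "i' = j"
  shows adjacent_sum_M: "l \<in> P \<Longrightarrow> (\<Sum>m\<in>M. n m / (l - m)) = 1 / 4"
    and adjacent_sum_P: "m \<in> M \<Longrightarrow> (\<Sum>l\<in>P. n l / (l - m)) = 1 / 4"
proof -
  have g: "g l m = 2 * n l * (n m / (l - m))" if "l \<in> P" "m \<in> M" for l m
  proof -
    have "(l - m) * g l m = 2 * n l * n m"
    proof -
      have "l \<in> S" "m \<in> S" "\<sigma> l = 1" "\<sigma> m = -1" using that by (auto simp: P_def M_def)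
      then show ?thesis using gap_times_g[of l m] w_j[of l] w_j[of m] assms by simp
    qed
    moreover have "l - m \<noteq> 0" using that PM_disjoint by auto
    ultimately have "g l m = 2 * n l * n m / (l - m)" by (metis eq_divide_imp mult.commute)
    then show ?thesis by simp
  qed
  have quarter: "x = 1 / 4" if "a / 2 = 2 * a * x" "a > 0" for a x :: real
    using that by simp
  show "(\<Sum>m\<in>M. n m / (l - m)) = 1 / 4" if l: "l \<in> P"
  proof -
    have "n l / 2 = 2 * n l * (\<Sum>m\<in>M. n m / (l - m))"
      using sum_M_g[of l] P_sub[OF l] unfolding sum_distrib_left by (simp add: g[OF l])
    then show ?thesis using n_pos[OF P_sub[OF l]] by (rule quarter)
  qed
  show "(\<Sum>l\<in>P. n l / (l - m)) = 1 / 4" if m: "m \<in> M"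
  proof -
    have "n m / 2 = (\<Sum>l\<in>P. 2 * n m * (n l / (l - m)))"
      using sum_P_g[of m] M_sub[OF m] by (simp add: g[OF _ m] mult_ac)
    then have "n m / 2 = 2 * n m * (\<Sum>l\<in>P. n l / (l - m))" by (simp only: sum_distrib_left)
    then show ?thesis using n_pos[OF M_sub[OF m]] by (rule quarter)
  qed
qed

text \<open>
  By partial fractions the vectors \<open>1 / (l - m)\<close> over \<open>m\<close>, weighted by \<open>n\<close>, are orthogonal for distinct \<open>l\<close>.
\<close>

lemma adjacent_sum_squares:
  assumes adj: "i' = j" and k: "k \<in> P"
  shows "n k * (\<Sum>m\<in>M. n m / (k - m)\<^sup>2) = 1 / 16"
proof -
  have ne: "l - m \<noteq> 0" if "l \<in> P" "m \<in> M" for l m using that PM_disjoint by auto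
  have orth: "(\<Sum>m\<in>M. n m / (k - m) / (l - m)) = 0" if l: "l \<in> P" "l \<noteq> k" for l
  proof -
    have "n m / (k - m) / (l - m) = (n m / (k - m) - n m / (l - m)) / (l - k)" if "m \<in> M" for m
      using ne[OF k that] ne[OF l(1) that] l(2) by (simp add: divide_simps) (simp add: algebra_simps)
    then have "(\<Sum>m\<in>M. n m / (k - m) / (l - m)) = (\<Sum>m\<in>M. (n m / (k - m) - n m / (l - m)) / (l - k))"
      by simp
    also have "\<dots> = ((\<Sum>m\<in>M. n m / (k - m)) - (\<Sum>m\<in>M. n m / (l - m))) / (l - k)"
      by (simp add: sum_subtractf sum_divide_distrib[symmetric])
    finally show ?thesis by (simp add: adjacent_sum_M[OF adj] k l)
  qed
  \<comment> \<open>A double sum over \<open>M\<close> and \<open>P\<close> in two orders: summing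
    over \<open>l\<close> first gives 1/16, summing over \<open>m\<close> first leaves only
    \<open>l = k\<close>.\<close>
  have "1 / 16 = (\<Sum>m\<in>M. n m / (k - m) * (1 / 4))"
    unfolding sum_distrib_right[symmetric] adjacent_sum_M[OF adj k] by simp
  also have "\<dots> = (\<Sum>m\<in>M. \<Sum>l\<in>P. n m / (k - m) * (n l / (l - m)))"
    unfolding sum_distrib_left[symmetric] by (rule sum.cong) (simp_all add: adjacent_sum_P[OF adj])
  also have "\<dots> = (\<Sum>l\<in>P. \<Sum>m\<in>M. n m / (k - m) * (n l / (l - m)))" by (rule sum.swap)
  also have "\<dots> = (\<Sum>l\<in>P. n l * (\<Sum>m\<in>M. n m / (k - m) / (l - m)))"
    by (simp add: sum_distrib_left mult_ac)
  also have "\<dots> = (\<Sum>l\<in>P. if l = k then n k * (\<Sum>m\<in>M. n m / (k - m) / (k - m)) else 0)"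
    by (rule sum.cong) (auto simp: orth simp del: divide_divide_eq_left)
  also have "\<dots> = n k * (\<Sum>m\<in>M. n m / (k - m)\<^sup>2)" using k by (simp add: power2_eq_square)
  finally show ?thesis by simp
qed

text \<open>Gaps of at least 2 bound the sum in \<open>adjacent_sum_squares\<close> by 1/4, so each
  \<open>n k\<close> with \<open>k \<in> P\<close> is at least 1/4. These weights total 1/2, hence a
  second element of \<open>P\<close> forces equality throughout.\<close>

lemma gap_eq_2_if_adjacent:
  assumes adj: "i' = j" and two: "P \<noteq> {l}" and l: "l \<in> P" and m: "m \<in> M"
  shows "(l - m)\<^sup>2 = 2"
proof -
  have inv: "n m / (k - m)\<^sup>2 \<le> n m / 2" if "k \<in> P" "m \<in> M" for k m
    using gap_ge_2[OF that] n_pos[of m] M_sub[OF that(2)] by (intro divide_left_mono) auto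
  have quarter: "n k \<ge> 1 / 4" if k: "k \<in> P" for k
  proof -
    have "(\<Sum>m\<in>M. n m / (k - m)\<^sup>2) \<le> (\<Sum>m\<in>M. n m / 2)" by (intro sum_mono inv k)
    also have "\<dots> = 1 / 4" by (simp add: sum_divide_distrib[symmetric] sum_n)
    finally have "n k * (\<Sum>m\<in>M. n m / (k - m)\<^sup>2) \<le> n k * (1 / 4)"
      using n_pos[of k] P_sub[OF k] by (intro mult_left_mono) auto
    then show ?thesis using adjacent_sum_squares[OF adj k] by simp
  qed
  obtain l' where l': "l' \<in> P" "l' \<noteq> l" using two l by auto
  have "n l + n l' = (\<Sum>k\<in>{l, l'}. n k)" using l' by simp
  also have "\<dots> \<le> (\<Sum>k\<in>P. n k)"
    using l l' n_pos P_sub by (intro sum_mono2) (auto intro: less_imp_le)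
  finally have "n l = 1 / 4" using quarter[OF l] quarter[OF l'(1)] sum_n by simp
  then have "(\<Sum>m\<in>M. n m / (l - m)\<^sup>2) = 1 / 4"
    using adjacent_sum_squares[OF adj l] by (simp only:)
  then have "(\<Sum>m\<in>M. n m / 2 - n m / (l - m)\<^sup>2) = 0"
    by (simp add: sum_subtractf sum_divide_distrib[symmetric] sum_n)
  then have "n m / 2 - n m / (l - m)\<^sup>2 = 0"
    using m inv[OF l] by (subst (asm) sum_nonneg_eq_0_iff) auto
  moreover have "n m > 0" using n_pos M_sub m by auto
  moreover have "(l - m)\<^sup>2 \<noteq> 0" using gap_ge_2[OF l m] by linarith
  ultimately have "n m * 2 = n m * (l - m)\<^sup>2" by (simp only: right_minus_eq frac_eq_eq zero_neq_numeral not_False_eq_True)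
  then show ?thesis using \<open>n m > 0\<close> by simp
qed

text \<open>Two elements of \<open>P\<close> equidistant from \<open>m\<close> have \<open>m\<close>
  as their midpoint.\<close>

lemma singleton_if_gaps_eq_2:
  assumes "\<And>l m. l \<in> P \<Longrightarrow> m \<in> M \<Longrightarrow> (l - m)\<^sup>2 = 2"
  shows "(\<exists>l. P = {l}) \<or> (\<exists>m. M = {m})"
proof (cases "\<exists>l. P = {l}")
  case False
  then obtain l l' where l: "l \<in> P" "l' \<in> P" "l \<noteq> l'" using P_nonempty by blast
  have "m = (l + l') / 2" if "m \<in> M" for m
  proof -
    have "(l - m)\<^sup>2 = (l' - m)\<^sup>2" using assms l that by simp
    then have "(l - l') * (l + l' - 2 * m) = 0" by (simp add: power2_eq_square algebra_simps)
    then show ?thesis using l by simp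
  qed
  then show ?thesis using M_nonempty by blast
qed simp

lemma singleton: "(\<exists>l. P = {l}) \<or> (\<exists>m. M = {m})"
proof (cases "\<exists>l. P = {l}")
  case False
  then have "(l - m)\<^sup>2 = 2" if "l \<in> P" "m \<in> M" for l m
    using gap_eq_2_if_adjacent[of l m] gap_eq_2_if_nonadjacent[of l m] that by blast
  then show ?thesis by (rule singleton_if_gaps_eq_2)
qed simp

text \<open>A singleton \<open>P\<close> or \<open>M\<close> makes
  \<open>axis i 1 + axis j 1\<close> or \<open>axis i 1 - axis j 1\<close> an eigenvector. Then no
  further vertex is adjacent to \<open>i\<close> or \<open>j\<close>, or the further neighbours of
  \<open>i\<close> and \<open>j\<close> coincide and the bridge leaves only
  \<open>i'\<close>.\<close>

lemma small_closed_set: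
  assumes entries: "\<And>u v. R $ u $ v \<ge> 0" and loopless: "\<And>u. R $ u $ u = 0"
  shows "\<exists>Z. i \<in> Z \<and> card Z \<le> 3 \<and> (\<forall>u\<in>Z. \<forall>v. v \<notin> Z \<longrightarrow> R $ u $ v = 0)"
proof -
  have col: "(R *v axis a 1) $ u = R $ u $ a" for a u
    by (simp add: matrix_vector_mult_basis column_def)
  have Rii': "R $ i $ i' = 1" using bridge i_C i'_C by simp
  have P_case: "R $ u $ i = 0 \<and> R $ u $ j = 0" if P: "P = {l}" and u: "u \<noteq> i" "u \<noteq> j" for u l
  proof -
    have "R *v (2 *\<^sub>R w l) = l *\<^sub>R (2 *\<^sub>R w l)" using eigen[of l] P_sub[of l] P
      by (simp add: matrix_vector_mult_scaleR)
    moreover have "2 *\<^sub>R w l = axis i 1 + axis j 1" using sum_P P by simp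
    ultimately have "R *v (axis i 1 + axis j 1) = l *\<^sub>R (axis i 1 + axis j 1)" by simp
    then have "(R *v axis i 1) $ u + (R *v axis j 1) $ u = l * (axis i 1 $ u + axis j 1 $ u)"
      by (simp add: matrix_vector_right_distrib vec_eq_iff)
    then have "R $ u $ i + R $ u $ j = 0" unfolding col using u by (simp add: axis_def)
    then show ?thesis using entries[of u i] entries[of u j] by simp
  qed
  have M_case: "R $ u $ i - R $ u $ j = m * (axis i 1 $ u - axis j 1 $ u)" if M: "M = {m}" for u m
  proof -
    have "R *v (2 *\<^sub>R w m) = m *\<^sub>R (2 *\<^sub>R w m)" using eigen[of m] M_sub[of m] M
      by (simp add: matrix_vector_mult_scaleR)
    moreover have "2 *\<^sub>R w m = axis i 1 - axis j 1" using sum_M M by simp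
    ultimately have "R *v (axis i 1 - axis j 1) = m *\<^sub>R (axis i 1 - axis j 1)" by simp
    then have "(R *v axis i 1) $ u - (R *v axis j 1) $ u = m * (axis i 1 $ u - axis j 1 $ u)"
      by (simp add: matrix_vector_mult_diff_distrib vec_eq_iff)
    then show ?thesis unfolding col .
  qed
  have common: "R $ u $ i = (if u = i' then 1 else 0) \<and> R $ u $ j = R $ u $ i"
    if M: "M = {m}" and u: "u \<noteq> i" "u \<noteq> j" for u m
  proof -
    have eq: "R $ u $ i = R $ u $ j" using M_case[OF M, of u] u by (simp add: axis_def)
    show ?thesis
    \<comment> \<open>A vertex of \<open>C\<close> other than \<open>i\<close> is not adjacent to
      \<open>j\<close>, and one outside \<open>C\<close> is adjacent to \<open>i\<close> only if it
      is \<open>i'\<close>.\<close>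
    proof (cases "u \<in> C")
      case True
      then show ?thesis using bridge[OF True j_C] eq u i'_C by auto
    next
      case False
      then show ?thesis using bridge[OF i_C False] eq sym[of u i] by simp
    qed
  qed
  show ?thesis
  proof (cases "i' = j")
    case True
    have zero: "R $ u $ i = 0 \<and> R $ u $ j = 0" if "u \<noteq> i" "u \<noteq> j" for u
      using singleton P_case[OF _ that] common[OF _ that] that True by auto
    have "R $ u $ v = 0" if "u \<in> {i, j}" "v \<notin> {i, j}" for u v
      using that zero[of v] sym[of u v] by auto
    moreover have "card {i, j} \<le> 3" using card_insert_le_m1[of 3 "{j}" i] by simp
    ultimately show ?thesis by blast
  next
    case False
    have i'_i: "i' \<noteq> i" using i_C i'_C by auto
    have "\<nexists>l. P = {l}" using P_case[of _ i'] i'_i False Rii' sym[of i' i] by auto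
    then obtain m where M: "M = {m}" using singleton by blast
    have "R $ i $ j = 0" using bridge[OF i_C j_C] False by auto
    then have "m = 0" using M_case[OF M, of i] distinct loopless by (simp add: axis_def)
    then have sq: "l\<^sup>2 = 2" if "l \<in> P" for l
      using gap_eq_2_if_nonadjacent[OF False that, of m] M by simp
    have ij: "R *v (axis i 1 + axis j 1) = 2 *\<^sub>R axis i' 1"
    proof -
      have "(R *v axis i 1) $ u + (R *v axis j 1) $ u = 2 * axis i' 1 $ u" for u
        unfolding col using common[OF M, of u] i'_i False loopless \<open>R $ i $ j = 0\<close> sym[of j i]
        by (cases "u = i"; cases "u = j") (auto simp: axis_def)
      then show ?thesis by (simp add: matrix_vector_right_distrib vec_eq_iff)
    qed
    \<comment> \<open>All eigenvalues in \<open>P\<close> square to 2, so \<open>R\<close> maps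
      \<open>axis i' 1\<close> back to \<open>axis i 1 + axis j 1\<close>; thus \<open>i'\<close>
      has no neighbours besides \<open>i\<close> and \<open>j\<close>.\<close>
    have "R *v (R *v (2 *\<^sub>R (\<Sum>l\<in>P. w l))) = 2 *\<^sub>R (2 *\<^sub>R (\<Sum>l\<in>P. w l))"
    proof -
      have "R *v (R *v w l) = 2 *\<^sub>R w l" if "l \<in> P" for l
        using eigen[OF P_sub[OF that]] sq[OF that]
        by (simp add: matrix_vector_mult_scaleR power2_eq_square)
      then have "(\<Sum>l\<in>P. R *v (R *v w l)) = 2 *\<^sub>R (\<Sum>l\<in>P. w l)"
        by (simp add: scaleR_sum_right)
      then show ?thesis by (simp add: matrix_vector_mult_scaleR vec.sum)
    qed
    then have "R *v (2 *\<^sub>R axis i' 1) = 2 *\<^sub>R (axis i 1 + axis j 1)" unfolding sum_P ij .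
    then have "R *v axis i' 1 = axis i 1 + axis j 1" by (simp add: matrix_vector_mult_scaleR)
    then have nb: "R $ u $ i' = axis i 1 $ u + axis j 1 $ u" for u using col[of i' u] by simp
    have "R $ u $ v = 0" if "u \<in> {i, i', j}" "v \<notin> {i, i', j}" for u v
      using that common[OF M, of v] nb[of v] sym[of u v] by (auto simp: axis_def)
    moreover have "card {i, i', j} \<le> 3" by (simp add: card_insert_if)
    ultimately show ?thesis by blast
  qed
qed

end

section \<open>Connected components and the theorem for graphs\<close>

lemma (in pair_graph) arc_sym: "(u, v) \<in> parcs G \<Longrightarrow> (v, u) \<in> parcs G"
  using pair_sym_arcs by (auto simp: symmetric_def sym_def)

lemma (in pair_graph) scc_of_closed:
  assumes "u \<in> scc_of x" "(u, v) \<in> parcs G"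
  shows "v \<in> scc_of x"
proof -
  have "x \<rightarrow>\<^sup>*\<^bsub>with_proj G\<^esub> v" "v \<rightarrow>\<^sup>*\<^bsub>with_proj G\<^esub> x"
    using assms arc_sym[OF assms(2)] unfolding scc_of_def
    by (auto intro: reachable_adj_trans adj_reachable_trans)
  then show ?thesis by (simp add: scc_of_def)
qed

lemma (in pair_graph) scc_of_subset_closed:
  assumes "x \<in> Z" "\<And>u v. u \<in> Z \<Longrightarrow> (u, v) \<in> parcs G \<Longrightarrow> v \<in> Z"
  shows "scc_of x \<subseteq> Z"
proof
  fix v assume "v \<in> scc_of x"
  then have "x \<rightarrow>\<^sup>*\<^bsub>with_proj G\<^esub> v" by (simp add: scc_of_def)
  then show "v \<in> Z" by (induction rule: reachable_induct) (use assms in auto)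
qed

lemma (in pair_graph) scc_of_eq: "y \<in> scc_of x \<Longrightarrow> scc_of y = scc_of x"
  unfolding scc_of_def by (auto intro: reachable_trans)

lemma pair_graph_delete_edge:
  assumes "pair_graph G"
  shows "pair_graph (delete_edge G u v)"
proof -
  interpret pair_graph G by fact
  show ?thesis
    by unfold_locales
      (use pair_sym_arcs pair_finite_verts pair_finite_arcs pair_no_loops arc_fst_in_verts arc_snd_in_verts
        in \<open>auto simp: delete_edge_def symmetric_def sym_def\<close>)
qed

text \<open>With \<open>C\<close> the component of \<open>i\<close> after deletion of the edge, the
  spectral argument yields a closed set of at most three vertices around \<open>i\<close>, too small
  for its component.\<close>

lemma no_perfect_state_transfer_over_bridge:
  fixes G :: "'v::finite pair_pre_digraph"
  assumes G: "pair_graph G" and V: "pverts G = UNIV"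
    and large: "card (pre_digraph.scc_of (with_proj G) i) > 3"
    and "i \<noteq> j" and arc: "(i, i') \<in> parcs G" and sep: "separates G i i' i j"
  shows "\<not> perfect_state_transfer G i j"
proof
  interpret G: pair_graph G by fact
  define H where "H = delete_edge G i i'"
  interpret H: pair_graph H unfolding H_def by (rule pair_graph_delete_edge[OF G])
  have H_arcs: "parcs H = parcs G - {(i, i'), (i', i)}" and H_verts: "pverts H = UNIV"
    by (simp_all add: H_def delete_edge_def V)
  define C where "C = H.scc_of i"
  have i_C: "i \<in> C" unfolding C_def using H_verts by (intro H.in_scc_of_self) simp
  have eq: "G.scc_of i = G.scc_of j" and neq: "H.scc_of i \<noteq> H.scc_of j"
    using sep by (simp_all add: separates_def H_def)
  have j_C: "j \<notin> C" using neq H.scc_of_eq[of j i] by (auto simp: C_def)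
  have C_closed: "v \<in> C" if "u \<in> C" "(u, v) \<in> parcs H" for u v
    using H.scc_of_closed that by (simp add: C_def)
  \<comment> \<open>With both ends of the deleted edge in \<open>C\<close>, this set would be closed
    in \<open>G\<close> and contain \<open>j\<close>.\<close>
  have i'_C: "i' \<notin> C"
  proof
    assume "i' \<in> C"
    then have "G.scc_of i \<subseteq> C"
      using i_C C_closed by (intro G.scc_of_subset_closed) (auto simp: H_arcs)
    moreover have "j \<in> G.scc_of i" unfolding eq using V by (intro G.in_scc_of_self) simp
    ultimately show False using j_C by blast
  qed
  assume "perfect_state_transfer G i j"
  then obtain t \<gamma> where t: "t > 0"
    and transfer: "matrix_exp (\<chi> u v. \<i> * of_real t * adjacency_matrix G $ u $ v) *v axis i 1 = \<gamma> *s axis j 1"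
    unfolding perfect_state_transfer_def by blast
  \<comment> \<open>A real copy of the adjacency matrix, so that the spectral decomposition takes
    place in a real inner product space.\<close>
  define R :: "real ^ 'v ^ 'v" where "R = (\<chi> u v. if (u, v) \<in> parcs G then 1 else 0)"
  have R: "R $ u $ v = (if (u, v) \<in> parcs G then 1 else 0)" for u v by (simp add: R_def)
  have sym: "R $ u $ v = R $ v $ u" for u v using G.arc_sym by (auto simp: R)
  have A: "adjacency_matrix G $ u $ v = of_real (R $ u $ v)" for u v
    by (simp add: adjacency_matrix_def R)
  obtain S w \<sigma> where "finite S" "\<And>l. l \<in> S \<Longrightarrow> w l \<noteq> 0" "\<And>l. l \<in> S \<Longrightarrow> R *v w l = l *\<^sub>R w l"
    "(\<Sum>l\<in>S. w l) = axis i 1" "(\<Sum>l\<in>S. \<sigma> l *\<^sub>R w l) = axis j 1"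
    "\<And>l. l \<in> S \<Longrightarrow> \<sigma> l = 1 \<or> \<sigma> l = -1" "\<And>l. l \<in> S \<Longrightarrow> cis (t * l) = of_real (\<sigma> l) * \<gamma>"
    using state_transfer_eigenvector_decomposition[of R, OF sym transfer[unfolded A]] by blast
  then interpret bridge_state_transfer R i j S w \<sigma> t \<gamma> C i'
  proof unfold_locales
    show "R $ u $ v = (if u = i \<and> v = i' then 1 else 0)" if "u \<in> C" "v \<notin> C" for u v
      using that C_closed[of u v] arc i'_C by (auto simp: R H_arcs)
  qed (use sym \<open>i \<noteq> j\<close> t i_C j_C i'_C in \<open>auto simp: R\<close>)
  obtain Z where Z: "i \<in> Z" "card Z \<le> 3" "\<And>u v. u \<in> Z \<Longrightarrow> v \<notin> Z \<Longrightarrow> R $ u $ v = 0"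
  proof -
    have "R $ u $ v \<ge> 0" "R $ u $ u = 0" for u v
      using G.pair_no_loops[of "(u, u)"] by (auto simp: R)
    then show thesis using small_closed_set that by blast
  qed
  have "G.scc_of i \<subseteq> Z"
  proof (rule G.scc_of_subset_closed)
    show "v \<in> Z" if "u \<in> Z" "(u, v) \<in> parcs G" for u v
      using Z(3)[of u v] that by (auto simp: R)
  qed (rule Z(1))
  then have "card (G.scc_of i) \<le> card Z" by (intro card_mono) auto
  then show False using large Z(2) by simp
qed

theorem theorem8:
  fixes G :: "'v::finite pair_pre_digraph" and i j i' j' :: 'v
  assumes "pair_graph G" and "pverts G = UNIV"
    and "card (pverts G) > 3"
    (* false without this: K2 plus two isolated vertices; automatic for connected G *)
    and "card (pre_digraph.scc_of (with_proj G) i) > 3"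
    and "i \<noteq> j"
    and "cut_edge G i i'" and "cut_edge G j j'"
    and "separates G i i' i j" and "separates G j j' i j"
  shows "\<not> perfect_state_transfer G i j \<and> \<not> perfect_state_transfer G j i"
proof
  have arcs: "(i, i') \<in> parcs G" "(j, j') \<in> parcs G" using assms(6,7) by (simp_all add: cut_edge_def)
  show "\<not> perfect_state_transfer G i j"
    by (rule no_perfect_state_transfer_over_bridge[OF assms(1,2,4,5) arcs(1) assms(8)])
  have "separates G j j' j i" "card (pre_digraph.scc_of (with_proj G) j) > 3"
    using assms(4,9) by (auto simp: separates_def)
  then show "\<not> perfect_state_transfer G j i"
    using no_perfect_state_transfer_over_bridge[OF assms(1,2) _ assms(5)[symmetric] arcs(2)] by blast
qed

end
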